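(* Let $A$ be a C$^*$-algebra, let $X$ be an essential Banach $A$-bimodule, and let $T: A\to X$ be a bounded linear operator. Then the following statements are equivalent: (a) $T$ is anti-derivable at zero, i.e. for all $a,b\in A$, $ab=0$ implies $T(b)a+bT(a)=0$; (b) There exist an anti-derivation $d:A\to X^{**}$ and an element $\xi\in X^{**}$ satisfying $\xi a = a\xi$, $\xi[a,b]=0$, $T(ab)=bT(a)+T(b)a-b\xi a$, and $T(a)=d(a)+\xi a$, for all $a,b\in A$.
   Context: All algebras and Banach spaces are complex; $A$ need not be unital. A Banach $A$-bimodule $X$ is essential if the linear span of $\{axb: a,b\in A,\ x\in X\}$ is dense in $X$. The commutator is $[a,b]=ab-ba$. The bidual $X^{**}$ is regarded as a Banach $A$-bimodule whose operations $z\mapsto az$ and $z\mapsto za$ ($a\in A$, $z\in X^{**}$) are the second adjoints of the maps $x\mapsto ax$ and $x\mapsto xa$ on $X$; $X$ is identified with its canonical image in $X^{**}$. An anti-derivation from $A$ into an $A$-bimodule $Y$ is a linear map $d:A\to Y$ with $d(ab)=d(b)a+b\,d(a)$ for all $a,b\in A$. *)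

theory Defs
  imports "HOL-Analysis.Analysis"
begin

section \<open>Complex normed spaces and C*-algebras\<close>

class complex_vector = real_vector +
  fixes scaleC :: "complex \<Rightarrow> 'a \<Rightarrow> 'a" (infixr \<open>*\<^sub>C\<close> 75)
  assumes scaleC_add_right: "c *\<^sub>C (x + y) = c *\<^sub>C x + c *\<^sub>C y"
    and scaleC_add_left: "(c + d) *\<^sub>C x = c *\<^sub>C x + d *\<^sub>C x"
    and scaleC_scaleC: "c *\<^sub>C d *\<^sub>C x = (c * d) *\<^sub>C x"
    and scaleC_one: "1 *\<^sub>C x = x"
    and scaleR_scaleC: "r *\<^sub>R x = complex_of_real r *\<^sub>C x"

class complex_normed_vector = complex_vector + real_normed_vector +
  assumes norm_scaleC: "norm (c *\<^sub>C x) = cmod c * norm x"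

class complex_banach = complex_normed_vector + banach

class complex_normed_algebra = complex_normed_vector + real_normed_algebra +
  assumes mult_scaleC_left: "(c *\<^sub>C x) * y = c *\<^sub>C (x * y)"
    and mult_scaleC_right: "x * (c *\<^sub>C y) = c *\<^sub>C (x * y)"

class cstar_algebra = complex_normed_algebra + complex_banach +
  fixes star :: "'a \<Rightarrow> 'a"
  assumes star_star: "star (star x) = x"
    and star_add: "star (x + y) = star x + star y"
    and star_scaleC: "star (c *\<^sub>C x) = cnj c *\<^sub>C star x"
    and star_mult: "star (x * y) = star y * star x"
    and cstar_identity: "norm (star x * x) = (norm x)\<^sup>2"

instantiation complex :: cstar_algebra
begin

definition "c *\<^sub>C (z::complex) = c * z"
definition "star (z::complex) = cnj z"

instance
  by standard
    (simp_all add: scaleC_complex_def star_complex_def algebra_simps norm_mult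
      power2_eq_square scaleR_conv_of_real)

end

lemma vector_space_scaleC: "vector_space (scaleC :: complex \<Rightarrow> 'a \<Rightarrow> 'a::complex_vector)"
  by unfold_locales (simp_all add: scaleC_add_right scaleC_add_left scaleC_scaleC scaleC_one)

abbreviation cspan :: "'a::complex_vector set \<Rightarrow> 'a set"
  where "cspan \<equiv> module.span scaleC"

abbreviation clinear :: "('a::complex_vector \<Rightarrow> 'b::complex_vector) \<Rightarrow> bool"
  where "clinear \<equiv> Vector_Spaces.linear scaleC scaleC"

definition bounded_clinear :: "('a::complex_normed_vector \<Rightarrow> 'b::complex_normed_vector) \<Rightarrow> bool"
  where "bounded_clinear f \<longleftrightarrow> bounded_linear f \<and> clinear f"

lemma clinearI:
  assumes "\<And>x y. f (x + y) = f x + f y" and "\<And>c x. f (c *\<^sub>C x) = c *\<^sub>C f x"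
  shows "clinear (f :: 'a::complex_vector \<Rightarrow> 'b::complex_vector)"
  using assms vector_space_scaleC[where 'a = 'a] vector_space_scaleC[where 'a = 'b]
  by (auto simp: Vector_Spaces.linear_def module_hom_def module_hom_axioms_def
      module_iff_vector_space)

lemma clinear_scaleC: "clinear f \<Longrightarrow> f (c *\<^sub>C x) = c *\<^sub>C f x"
  by (simp add: Vector_Spaces.linear_def module_hom_def module_hom_axioms_def)

lemma bounded_clinear_iff:
  "bounded_clinear f \<longleftrightarrow> bounded_linear f \<and> (\<forall>c x. f (c *\<^sub>C x) = c *\<^sub>C f x)"
  unfolding bounded_clinear_def
  by (auto intro: clinearI simp: clinear_scaleC linear_add bounded_linear.linear)


section \<open>The dual space\<close>

typedef (overloaded) 'a cdual =
  "{\<phi> :: 'a::complex_normed_vector \<Rightarrow>\<^sub>L complex. clinear (blinfun_apply \<phi>)}"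
  morphisms blinfun_of_cdual Abs_cdual
  by (rule exI[of _ 0]) (auto intro!: clinearI simp: scaleC_complex_def)

setup_lifting type_definition_cdual

lift_definition cdual_apply :: "'a::complex_normed_vector cdual \<Rightarrow> 'a \<Rightarrow> complex"
  is blinfun_apply .

lemma cdual_eqI: "(\<And>x. cdual_apply \<phi> x = cdual_apply \<psi> x) \<Longrightarrow> \<phi> = \<psi>"
  by transfer (rule blinfun_eqI)

lemma cdual_apply_add: "cdual_apply \<phi> (x + y) = cdual_apply \<phi> x + cdual_apply \<phi> y"
  by transfer (simp add: blinfun.add_right)

lemma cdual_apply_scaleC: "cdual_apply \<phi> (c *\<^sub>C x) = c * cdual_apply \<phi> x"
  by transfer (simp add: clinear_scaleC scaleC_complex_def)

lemma clinear_blinfunI: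
  "(\<And>c x. blinfun_apply \<phi> (c *\<^sub>C x) = c * blinfun_apply \<phi> x) \<Longrightarrow> clinear (blinfun_apply \<phi>)"
  by (rule clinearI) (simp_all add: scaleC_complex_def blinfun.add_right)

instantiation cdual :: (complex_normed_vector) complex_normed_vector
begin

lift_definition zero_cdual :: "'a cdual" is 0
  by (rule clinear_blinfunI) simp

lift_definition plus_cdual :: "'a cdual \<Rightarrow> 'a cdual \<Rightarrow> 'a cdual" is "(+)"
  by (rule clinear_blinfunI)
    (simp add: blinfun.add_left clinear_scaleC scaleC_complex_def algebra_simps)

lift_definition minus_cdual :: "'a cdual \<Rightarrow> 'a cdual \<Rightarrow> 'a cdual" is "(-)"
  by (rule clinear_blinfunI)
    (simp add: blinfun.diff_left clinear_scaleC scaleC_complex_def algebra_simps)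

lift_definition uminus_cdual :: "'a cdual \<Rightarrow> 'a cdual" is uminus
  by (rule clinear_blinfunI) (simp add: blinfun.minus_left clinear_scaleC scaleC_complex_def)

lift_definition scaleR_cdual :: "real \<Rightarrow> 'a cdual \<Rightarrow> 'a cdual" is scaleR
  by (rule clinear_blinfunI)
    (simp add: blinfun.scaleR_left clinear_scaleC scaleC_complex_def scaleR_conv_of_real)

lift_definition scaleC_cdual :: "complex \<Rightarrow> 'a cdual \<Rightarrow> 'a cdual"
  is "\<lambda>c \<phi>. blinfun_mult_right c o\<^sub>L \<phi>"
  by (rule clinear_blinfunI) (simp add: clinear_scaleC scaleC_complex_def)

lift_definition norm_cdual :: "'a cdual \<Rightarrow> real" is norm .

lift_definition dist_cdual :: "'a cdual \<Rightarrow> 'a cdual \<Rightarrow> real" is dist .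

definition sgn_cdual :: "'a cdual \<Rightarrow> 'a cdual"
  where "sgn_cdual \<phi> = scaleR (inverse (norm \<phi>)) \<phi>"

definition uniformity_cdual :: "('a cdual \<times> 'a cdual) filter"
  where "uniformity_cdual = (INF e\<in>{0 <..}. principal {(\<phi>, \<psi>). dist \<phi> \<psi> < e})"

definition open_cdual :: "'a cdual set \<Rightarrow> bool"
  where "open_cdual S = (\<forall>\<phi>\<in>S. \<forall>\<^sub>F (\<phi>', \<psi>) in uniformity. \<phi>' = \<phi> \<longrightarrow> \<psi> \<in> S)"

instance
proof
  fix \<phi> \<psi> \<theta> :: "'a cdual" and r s :: real and c d :: complex
  show "\<phi> + \<psi> + \<theta> = \<phi> + (\<psi> + \<theta>)" by transfer simp
  show "\<phi> + \<psi> = \<psi> + \<phi>" by transfer simp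
  show "0 + \<phi> = \<phi>" by transfer simp
  show "- \<phi> + \<phi> = 0" by transfer simp
  show "\<phi> - \<psi> = \<phi> + - \<psi>" by transfer simp
  show "r *\<^sub>R (\<phi> + \<psi>) = r *\<^sub>R \<phi> + r *\<^sub>R \<psi>" by transfer (simp add: algebra_simps)
  show "(r + s) *\<^sub>R \<phi> = r *\<^sub>R \<phi> + s *\<^sub>R \<phi>" by transfer (simp add: algebra_simps)
  show "r *\<^sub>R s *\<^sub>R \<phi> = (r * s) *\<^sub>R \<phi>" by transfer simp
  show "1 *\<^sub>R \<phi> = \<phi>" by transfer simp
  show "c *\<^sub>C (\<phi> + \<psi>) = c *\<^sub>C \<phi> + c *\<^sub>C \<psi>"
    by transfer (auto intro!: blinfun_eqI simp: blinfun.add_left algebra_simps)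
  show "(c + d) *\<^sub>C \<phi> = c *\<^sub>C \<phi> + d *\<^sub>C \<phi>"
    by transfer (auto intro!: blinfun_eqI simp: blinfun.add_left algebra_simps)
  show "c *\<^sub>C d *\<^sub>C \<phi> = (c * d) *\<^sub>C \<phi>"
    by transfer (auto intro!: blinfun_eqI)
  show "1 *\<^sub>C \<phi> = \<phi>"
    by transfer (auto intro!: blinfun_eqI)
  show "r *\<^sub>R \<phi> = complex_of_real r *\<^sub>C \<phi>"
    by transfer (auto intro!: blinfun_eqI simp: blinfun.scaleR_left scaleR_conv_of_real)
  show "dist \<phi> \<psi> = norm (\<phi> - \<psi>)" by transfer (rule dist_norm)
  show "(norm \<phi> = 0) = (\<phi> = 0)" by transfer simp
  show "norm (\<phi> + \<psi>) \<le> norm \<phi> + norm \<psi>" by transfer (rule norm_triangle_ineq)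
  show "norm (r *\<^sub>R \<phi>) = \<bar>r\<bar> * norm \<phi>" by transfer simp
  show "norm (c *\<^sub>C \<phi>) = cmod c * norm \<phi>"
  proof (transfer fixing: c)
    fix \<phi> :: "'a \<Rightarrow>\<^sub>L complex"
    have "norm (blinfun_mult_right c o\<^sub>L \<phi>) \<le> cmod c * norm \<phi>" for c
      by (rule norm_blinfun_bound)
        (auto simp: norm_mult mult.assoc intro!: mult_left_mono norm_blinfun)
    note le = this
    show "norm (blinfun_mult_right c o\<^sub>L \<phi>) = cmod c * norm \<phi>"
    proof (cases "c = 0")
      case True
      then show ?thesis using le[of c] by simp
    next
      case False
      have "cmod c * norm (blinfun_apply \<phi> x) \<le> norm (blinfun_mult_right c o\<^sub>L \<phi>) * norm x" for x
        using norm_blinfun[of "blinfun_mult_right c o\<^sub>L \<phi>" x] by (simp add: norm_mult)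
      then have "norm \<phi> \<le> norm (blinfun_mult_right c o\<^sub>L \<phi>) / cmod c"
        using False by (intro norm_blinfun_bound) (auto simp: field_simps)
      then show ?thesis
        using le[of c] False by (simp add: field_simps)
    qed
  qed
qed (fact sgn_cdual_def uniformity_cdual_def open_cdual_def)+

end

instance cdual :: (complex_normed_vector) complex_banach
proof
  fix X :: "nat \<Rightarrow> 'a cdual"
  assume "Cauchy X"
  have dist: "dist \<phi> \<psi> = dist (blinfun_of_cdual \<phi>) (blinfun_of_cdual \<psi>)" for \<phi> \<psi> :: "'a cdual"
    by transfer simp
  from \<open>Cauchy X\<close> have "Cauchy (\<lambda>n. blinfun_of_cdual (X n))"
    by (simp add: Cauchy_def dist)
  then obtain L where L: "(\<lambda>n. blinfun_of_cdual (X n)) \<longlonglongrightarrow> L"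
    by (auto simp: Cauchy_convergent_iff convergent_def)
  have lim: "(\<lambda>n. cdual_apply (X n) x) \<longlonglongrightarrow> blinfun_apply L x" for x
    using blinfun.tendsto[OF L tendsto_const[of x]] by (simp add: cdual_apply.rep_eq)
  have "blinfun_apply L (c *\<^sub>C x) = c * blinfun_apply L x" for c x
    using LIMSEQ_unique[OF lim[of "c *\<^sub>C x"]] tendsto_mult[OF tendsto_const[of c] lim[of x]]
    by (simp add: cdual_apply_scaleC)
  then have "blinfun_of_cdual (Abs_cdual L) = L"
    by (intro Abs_cdual_inverse) (auto intro: clinear_blinfunI)
  with L have "X \<longlonglongrightarrow> Abs_cdual L"
    by (simp add: lim_sequentially dist)
  then show "convergent X" by (auto simp: convergent_def)
qed

lemma cdual_apply_zero_left [simp]: "cdual_apply 0 x = 0"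
  by transfer simp

lemma cdual_apply_add_left: "cdual_apply (\<phi> + \<psi>) x = cdual_apply \<phi> x + cdual_apply \<psi> x"
  by transfer (simp add: blinfun.add_left)

lemma cdual_apply_scaleC_left: "cdual_apply (c *\<^sub>C \<phi>) x = c * cdual_apply \<phi> x"
  by transfer simp

lemma cdual_apply_scaleR_left: "cdual_apply (r *\<^sub>R \<phi>) x = r *\<^sub>R cdual_apply \<phi> x"
  by transfer (simp add: blinfun.scaleR_left)

lemma norm_cdual_apply: "norm (cdual_apply \<phi> x) \<le> norm \<phi> * norm x"
  by transfer (rule norm_blinfun)

lemma norm_cdual_bound:
  "0 \<le> b \<Longrightarrow> (\<And>x. norm (cdual_apply \<phi> x) \<le> b * norm x) \<Longrightarrow> norm \<phi> \<le> b"
  by transfer (rule norm_blinfun_bound)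

lemma bounded_clinear_cdual_apply: "bounded_clinear (cdual_apply \<phi>)"
  unfolding bounded_clinear_def
  by transfer (simp add: blinfun.bounded_linear_right)

definition cdual_of :: "('a::complex_normed_vector \<Rightarrow> complex) \<Rightarrow> 'a cdual"
  where "cdual_of f = Abs_cdual (Blinfun f)"

lemma cdual_apply_cdual_of: "bounded_clinear f \<Longrightarrow> cdual_apply (cdual_of f) = f"
  by (simp add: cdual_apply.rep_eq cdual_of_def bounded_clinear_def Abs_cdual_inverse
      bounded_linear_Blinfun_apply)


section \<open>Canonical embedding and adjoints\<close>

text \<open>\<open>cadjoint T\<close> is meaningful only for \<open>bounded_clinear T\<close>.\<close>

definition cadjoint ::
  "('a::complex_normed_vector \<Rightarrow> 'b::complex_normed_vector) \<Rightarrow> 'b cdual \<Rightarrow> 'a cdual"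
  where "cadjoint T \<phi> = cdual_of (\<lambda>x. cdual_apply \<phi> (T x))"

definition bidual_embed :: "'a::complex_normed_vector \<Rightarrow> 'a cdual cdual"
  where "bidual_embed x = cdual_of (\<lambda>\<phi>. cdual_apply \<phi> x)"

lemma cdual_apply_cadjoint:
  assumes "bounded_clinear T"
  shows "cdual_apply (cadjoint T \<phi>) x = cdual_apply \<phi> (T x)"
proof -
  have "bounded_clinear (\<lambda>x. cdual_apply \<phi> (T x))"
    using assms bounded_clinear_cdual_apply[of \<phi>]
    by (auto simp: bounded_clinear_iff intro: bounded_linear_compose)
  then show ?thesis by (simp add: cadjoint_def cdual_apply_cdual_of)
qed

lemma norm_cadjoint_le:
  assumes "bounded_clinear T"
    and "\<And>x. norm (T x) \<le> K * norm x" and "0 \<le> K"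
  shows "norm (cadjoint T \<phi>) \<le> norm \<phi> * K"
proof (rule norm_cdual_bound)
  fix x
  have "norm (cdual_apply \<phi> (T x)) \<le> norm \<phi> * norm (T x)" by (rule norm_cdual_apply)
  also have "\<dots> \<le> norm \<phi> * (K * norm x)" by (intro mult_left_mono assms) simp
  finally show "norm (cdual_apply (cadjoint T \<phi>) x) \<le> norm \<phi> * K * norm x"
    by (simp add: cdual_apply_cadjoint assms mult.assoc)
qed (use assms in simp)

lemma bounded_clinear_cadjoint:
  assumes "bounded_clinear T"
  shows "bounded_clinear (cadjoint T)"
proof -
  from assms obtain K where "0 \<le> K" "\<And>x. norm (T x) \<le> K * norm x"
    unfolding bounded_clinear_def using bounded_linear.nonneg_bounded
    by (metis mult.commute)
  then have "bounded_linear (cadjoint T)"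
    by (intro bounded_linear_intro[where K = K] cdual_eqI norm_cadjoint_le assms)
      (simp_all add: cdual_apply_cadjoint assms cdual_apply_add_left cdual_apply_scaleR_left)
  then show ?thesis
    by (auto simp: bounded_clinear_iff cdual_apply_cadjoint[OF assms] cdual_apply_scaleC_left
        intro!: cdual_eqI)
qed

lemma cdual_apply_bidual_embed: "cdual_apply (bidual_embed x) \<phi> = cdual_apply \<phi> x"
proof -
  have "bounded_clinear (\<lambda>\<phi>. cdual_apply \<phi> x)"
    unfolding bounded_clinear_iff
    by (auto intro!: bounded_linear_intro[where K = "norm x"] norm_cdual_apply
        simp: cdual_apply_add_left cdual_apply_scaleR_left cdual_apply_scaleC_left
          scaleC_complex_def)
  then show ?thesis by (simp add: bidual_embed_def cdual_apply_cdual_of)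
qed


section \<open>Banach bimodules\<close>

text \<open>Joint continuity is required with an arbitrary constant.\<close>

locale banach_bimodule =
  fixes lact :: "'a::complex_normed_algebra \<Rightarrow> 'x::complex_banach \<Rightarrow> 'x"
    and ract :: "'x \<Rightarrow> 'a \<Rightarrow> 'x"
  assumes bounded_bilinear_lact: "bounded_bilinear lact"
    and bounded_bilinear_ract: "bounded_bilinear ract"
    and lact_scaleC_left: "lact (c *\<^sub>C a) x = c *\<^sub>C lact a x"
    and lact_scaleC_right: "lact a (c *\<^sub>C x) = c *\<^sub>C lact a x"
    and ract_scaleC_left: "ract (c *\<^sub>C x) a = c *\<^sub>C ract x a"
    and ract_scaleC_right: "ract x (c *\<^sub>C a) = c *\<^sub>C ract x a"
    and lact_mult: "lact (a * b) x = lact a (lact b x)"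
    and ract_mult: "ract x (a * b) = ract (ract x a) b"
    and lact_ract: "lact a (ract x b) = ract (lact a x) b"

definition essential_bimodule ::
  "('a \<Rightarrow> 'x::complex_banach \<Rightarrow> 'x) \<Rightarrow> ('x \<Rightarrow> 'a \<Rightarrow> 'x) \<Rightarrow> bool"
  where "essential_bimodule lact ract \<longleftrightarrow>
    closure (cspan {ract (lact a x) b | a x b. True}) = UNIV"

definition bidual_lact ::
  "('a \<Rightarrow> 'x::complex_banach \<Rightarrow> 'x) \<Rightarrow> 'a \<Rightarrow> 'x cdual cdual \<Rightarrow> 'x cdual cdual"
  where "bidual_lact lact a = cadjoint (cadjoint (\<lambda>x. lact a x))"

definition bidual_ract ::
  "('x::complex_banach \<Rightarrow> 'a \<Rightarrow> 'x) \<Rightarrow> 'x cdual cdual \<Rightarrow> 'a \<Rightarrow> 'x cdual cdual"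
  where "bidual_ract ract z a = cadjoint (cadjoint (\<lambda>x. ract x a)) z"

context banach_bimodule
begin

lemma bounded_clinear_lact: "bounded_clinear (lact a)"
  by (simp add: bounded_clinear_iff lact_scaleC_right
      bounded_bilinear.bounded_linear_right[OF bounded_bilinear_lact])

lemma bounded_clinear_ract: "bounded_clinear (\<lambda>x. ract x a)"
  by (simp add: bounded_clinear_iff ract_scaleC_left
      bounded_bilinear.bounded_linear_left[OF bounded_bilinear_ract])

lemma bidual_lact_embed: "bidual_lact lact a (bidual_embed x) = bidual_embed (lact a x)"
  by (rule cdual_eqI)
    (simp add: bidual_lact_def cdual_apply_cadjoint cdual_apply_bidual_embed
      bounded_clinear_cadjoint bounded_clinear_lact)

lemma bidual_ract_embed: "bidual_ract ract (bidual_embed x) a = bidual_embed (ract x a)"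
  by (rule cdual_eqI)
    (simp add: bidual_ract_def cdual_apply_cadjoint cdual_apply_bidual_embed
      bounded_clinear_cadjoint bounded_clinear_ract)

lemmas cdual_apply_bidual_lact =
    cdual_apply_cadjoint[OF bounded_clinear_cadjoint[OF bounded_clinear_lact],
      folded bidual_lact_def]
  and cdual_apply_bidual_ract =
    cdual_apply_cadjoint[OF bounded_clinear_cadjoint[OF bounded_clinear_ract],
      folded bidual_ract_def]
  and cdual_apply_cadjoint_lact = cdual_apply_cadjoint[OF bounded_clinear_lact]
  and cdual_apply_cadjoint_ract = cdual_apply_cadjoint[OF bounded_clinear_ract]

end

lemma banach_bimodule_bidual:
  assumes "banach_bimodule lact ract"
  shows "banach_bimodule (bidual_lact lact) (bidual_ract ract)"
proof -
  interpret banach_bimodule lact ract by fact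
  note app = cdual_apply_bidual_lact cdual_apply_bidual_ract
    cdual_apply_cadjoint_lact cdual_apply_cadjoint_ract
    cdual_apply_add cdual_apply_add_left cdual_apply_scaleC cdual_apply_scaleC_left
    cdual_apply_scaleR_left
  have scaleR: "cdual_apply \<phi> (r *\<^sub>R x) = r *\<^sub>R cdual_apply \<phi> x"
    for \<phi> :: "'c::complex_normed_vector cdual" and r x
    by (simp add: scaleR_scaleC[of _ x] cdual_apply_scaleC scaleR_conv_of_real)
  note l = bounded_bilinear.add_left[OF bounded_bilinear_lact]
    bounded_bilinear.scaleR_left[OF bounded_bilinear_lact]
  note r = bounded_bilinear.add_right[OF bounded_bilinear_ract]
    bounded_bilinear.scaleR_right[OF bounded_bilinear_ract]
  have cadjoint_lact:
    "cadjoint (lact (a + b)) \<phi> = cadjoint (lact a) \<phi> + cadjoint (lact b) \<phi>"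
    "cadjoint (lact (s *\<^sub>R a)) \<phi> = s *\<^sub>R cadjoint (lact a) \<phi>"
    "cadjoint (lact (c *\<^sub>C a)) \<phi> = c *\<^sub>C cadjoint (lact a) \<phi>"
    "cadjoint (lact (a * b)) \<phi> = cadjoint (lact b) (cadjoint (lact a) \<phi>)" for a b s c \<phi>
    by (rule cdual_eqI; simp add: app l scaleR lact_scaleC_left lact_mult)+
  have cadjoint_ract:
    "cadjoint (\<lambda>x. ract x (a + b)) \<phi> = cadjoint (\<lambda>x. ract x a) \<phi> + cadjoint (\<lambda>x. ract x b) \<phi>"
    "cadjoint (\<lambda>x. ract x (s *\<^sub>R a)) \<phi> = s *\<^sub>R cadjoint (\<lambda>x. ract x a) \<phi>"
    "cadjoint (\<lambda>x. ract x (c *\<^sub>C a)) \<phi> = c *\<^sub>C cadjoint (\<lambda>x. ract x a) \<phi>"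
    "cadjoint (\<lambda>x. ract x (a * b)) \<phi> = cadjoint (\<lambda>x. ract x a) (cadjoint (\<lambda>x. ract x b) \<phi>)"
    "cadjoint (\<lambda>x. ract x b) (cadjoint (lact a) \<phi>) = cadjoint (lact a) (cadjoint (\<lambda>x. ract x b) \<phi>)"
    for a b s c \<phi>
    by (rule cdual_eqI; simp only: app;
        simp add: app r scaleR ract_scaleC_right ract_mult lact_ract)+
  obtain K where K: "0 \<le> K" "\<And>a x. norm (lact a x) \<le> norm a * norm x * K"
    using bounded_bilinear.nonneg_bounded[OF bounded_bilinear_lact] by blast
  obtain M where M: "0 \<le> M" "\<And>a x. norm (ract x a) \<le> norm x * norm a * M"
    using bounded_bilinear.nonneg_bounded[OF bounded_bilinear_ract] by blast
  have nl: "norm (bidual_lact lact a z) \<le> norm a * norm z * K" for a z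
  proof -
    have "norm (cadjoint (lact a) \<phi>) \<le> norm \<phi> * (K * norm a)" for \<phi>
      by (rule norm_cadjoint_le[OF bounded_clinear_lact]) (use K in \<open>simp_all add: ac_simps\<close>)
    then have "norm (bidual_lact lact a z) \<le> norm z * (K * norm a)"
      unfolding bidual_lact_def
      by (intro norm_cadjoint_le bounded_clinear_cadjoint bounded_clinear_lact)
        (use K in \<open>simp_all add: ac_simps\<close>)
    then show ?thesis by (simp add: ac_simps)
  qed
  have nr: "norm (bidual_ract ract z a) \<le> norm z * norm a * M" for a z
  proof -
    have "norm (cadjoint (\<lambda>x. ract x a) \<phi>) \<le> norm \<phi> * (M * norm a)" for \<phi>
      by (rule norm_cadjoint_le[OF bounded_clinear_ract]) (use M in \<open>simp_all add: ac_simps\<close>)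
    then have "norm (bidual_ract ract z a) \<le> norm z * (M * norm a)"
      unfolding bidual_ract_def
      by (intro norm_cadjoint_le bounded_clinear_cadjoint bounded_clinear_ract)
        (use M in \<open>simp_all add: ac_simps\<close>)
    then show ?thesis by (simp add: ac_simps)
  qed
  show ?thesis
  proof
    show "\<exists>K. \<forall>a b. norm (bidual_lact lact a b) \<le> norm a * norm b * K" using nl by blast
    show "\<exists>K. \<forall>a b. norm (bidual_ract ract a b) \<le> norm a * norm b * K" using nr by blast
  qed (rule cdual_eqI; simp add: app scaleR cadjoint_lact cadjoint_ract)+
qed


section \<open>Anti-derivations\<close>

definition commutator :: "'a::ring \<Rightarrow> 'a \<Rightarrow> 'a"
  where "commutator a b = a * b - b * a"

definition anti_derivation ::
  "('a::complex_normed_algebra \<Rightarrow> 'y::complex_vector \<Rightarrow> 'y) \<Rightarrow> ('y \<Rightarrow> 'a \<Rightarrow> 'y) \<Rightarrow>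
    ('a \<Rightarrow> 'y) \<Rightarrow> bool"
  where "anti_derivation lact ract d \<longleftrightarrow>
    clinear d \<and> (\<forall>a b. d (a * b) = ract (d b) a + lact b (d a))"

definition anti_derivable_at_zero ::
  "('a::complex_normed_algebra \<Rightarrow> 'y::complex_vector \<Rightarrow> 'y) \<Rightarrow> ('y \<Rightarrow> 'a \<Rightarrow> 'y) \<Rightarrow>
    ('a \<Rightarrow> 'y) \<Rightarrow> bool"
  where "anti_derivable_at_zero lact ract T \<longleftrightarrow>
    (\<forall>a b. a * b = 0 \<longrightarrow> ract (T b) a + lact b (T a) = 0)"

end

theory Submission
  imports Defs
begin

text \<open>
  From the representation to zero products: if \<open>ab = 0\<close> then \<open>\<xi>ba = \<xi>ab = 0\<close>, because \<open>\<xi>\<close> is central and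
  kills commutators, so the product formula for \<open>T(ab) = T(0)\<close> leaves \<open>bT(a) + T(b)a = 0\<close> in the
  bidual, and the embedding into the bidual is injective (Hahn-Banach).

  The converse has three ingredients.

  The first is that a bounded bilinear map \<open>\<phi>\<close> on a C*-algebra with \<open>\<phi>(a,b) = 0\<close> whenever \<open>ab = 0\<close> is
  balanced: \<open>\<phi>(ab,c) = \<phi>(a,bc)\<close> (\<open>zero_product_balanced\<close>). It is enough to treat a small self-adjoint
  \<open>b = h\<close>. Its Cayley transform \<open>u = (1 + ih)(1 - ih)\<^sup>-\<^sup>1\<close> is unitary, and \<open>\<phi>(au,c) = \<phi>(a,uc)\<close> for all
  \<open>a\<close>, \<open>c\<close> is equivalent to \<open>\<phi>(ah,c) = \<phi>(a,hc)\<close> by clearing denominators. Zero products come from the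
  functions \<open>\<bar>sin\<bar> + sin\<close> and \<open>\<bar>sin\<bar> - sin\<close> of the angle, whose product vanishes and whose Fourier series
  converge absolutely, so that they can be evaluated at \<open>u\<close> without any spectral theory. All their
  rotations are available too, and comparing a single Fourier coefficient in the angle of rotation
  shows that the third difference of the bounded sequence \<open>n \<mapsto> \<phi>(au\<^sup>n, u\<^sup>1\<^sup>-\<^sup>nc)\<close> is zero. A bounded
  sequence with zero third difference is constant (\<open>zero_product_shift\<close>).

  The second is a bounded approximate unit \<open>(e)\<close> of the algebra, built from ergodic means of the same
  Cayley transforms (\<open>approximate_unit\<close>). For \<open>\<phi>(a,b) = T(b)a + bT(a)\<close> the balance identity reads
  \<open>T(c)ab + cT(ab) = T(bc)a + bcT(a)\<close>. Let \<open>\<xi>\<close> be a weak* cluster point of \<open>T(e)\<close>. Putting \<open>c = e\<close> gives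
  \<open>T(ab) = T(b)a + bT(a) - \<xi>ab\<close>, putting \<open>a = e\<close> gives the same formula with \<open>ab\<xi>\<close>, and therefore
  \<open>\<xi>\<close> is central (\<open>anti_derivable_at_zero_multiplier\<close>).

  The third shows that \<open>\<xi>\<close> kills commutators. The map \<open>d(a) = T(a) - \<xi>a\<close> is an anti-derivation up to
  the term \<open>-2\<xi>[a,b]\<close>. Associativity of the product then gives \<open>d(c)[a,b] = [b,c]d(a)\<close>, in particular
  \<open>d(b)[a,b] = 0\<close>, and applying consequences of this to \<open>d(ab)\<close> leaves \<open>\<xi>zxz = 0\<close> for every commutator
  \<open>z\<close> and every \<open>x\<close>. The annihilator of \<open>\<xi>\<close> is a closed right ideal, and closed right ideals of a
  C*-algebra contain \<open>x\<close> as soon as they contain \<open>xx*\<close>; so \<open>\<xi>z = 0\<close>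
  (\<open>central_multiplier_annihilates_commutators\<close>), and \<open>d\<close> is an anti-derivation.
\<close>

section \<open>Complex scalars and separation by functionals\<close>

lemma bounded_bilinear_scaleC:
  "bounded_bilinear (scaleC :: complex \<Rightarrow> 'a \<Rightarrow> 'a::complex_normed_vector)"
proof
  fix c d :: complex and x y :: 'a and r :: real
  show "(c + d) *\<^sub>C x = c *\<^sub>C x + d *\<^sub>C x" by (rule scaleC_add_left)
  show "c *\<^sub>C (x + y) = c *\<^sub>C x + c *\<^sub>C y" by (rule scaleC_add_right)
  show "(r *\<^sub>R c) *\<^sub>C x = r *\<^sub>R c *\<^sub>C x"
    by (simp add: scaleR_scaleC[of r "c *\<^sub>C x"] scaleC_scaleC scaleR_conv_of_real)
  show "c *\<^sub>C r *\<^sub>R x = r *\<^sub>R c *\<^sub>C x"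
    by (simp add: scaleR_scaleC scaleC_scaleC mult.commute)
  show "\<exists>K. \<forall>c (x::'a). norm (c *\<^sub>C x) \<le> norm c * norm x * K"
    by (rule exI[of _ 1]) (simp add: norm_scaleC)
qed

interpretation scaleC: bounded_bilinear "scaleC :: complex \<Rightarrow> 'a \<Rightarrow> 'a::complex_normed_vector"
  by (rule bounded_bilinear_scaleC)

lemma scaleC_cancel_left:
  fixes x y :: "'a::complex_normed_vector"
  assumes "c *\<^sub>C x = c *\<^sub>C y" "c \<noteq> 0"
  shows "x = y"
proof -
  have "inverse c *\<^sub>C c *\<^sub>C x = inverse c *\<^sub>C c *\<^sub>C y" by (simp add: assms)
  then show ?thesis by (simp add: scaleC_scaleC scaleC_one assms(2))
qed

definition sublinear :: "('a::real_vector \<Rightarrow> real) \<Rightarrow> bool"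
  where "sublinear q \<longleftrightarrow> (\<forall>x y. q (x + y) \<le> q x + q y) \<and> (\<forall>t x. t \<ge> 0 \<longrightarrow> q (t *\<^sub>R x) = t * q x)"

text \<open>
  A modification of a sublinear \<open>q\<close> that is forced down along the ray through \<open>y\<close>: its value
  at \<open>-y\<close> is at most \<open>-q y\<close> (take \<open>t = 1\<close>). It serves twice, to show that minimal sublinear
  functionals are additive and to prescribe the value of a linear functional at a given vector.
\<close>

definition tilt :: "('a::real_vector \<Rightarrow> real) \<Rightarrow> 'a \<Rightarrow> 'a \<Rightarrow> real"
  where "tilt q y x = (INF t\<in>{0..}. q (x + t *\<^sub>R y) - t * q y)"

lemma sublinear_lower:
  assumes "sublinear q"
  shows "- q (- x) \<le> q x" and "q 0 = 0"
proof -
  have "q ((0::real) *\<^sub>R 0) = 0 * q 0" using assms unfolding sublinear_def by blast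
  then show z: "q 0 = 0" by simp
  have "q (x + - x) \<le> q x + q (- x)" using assms unfolding sublinear_def by blast
  then show "- q (- x) \<le> q x" using z by simp
qed

lemma tilt_bound:
  assumes q: "sublinear q" and t: "t \<ge> 0"
  shows "- q (- x) \<le> q (x + t *\<^sub>R y) - t * q y"
proof -
  have "q (t *\<^sub>R y) = q ((x + t *\<^sub>R y) + - x)" by simp
  also have "\<dots> \<le> q (x + t *\<^sub>R y) + q (- x)" using q unfolding sublinear_def by blast
  finally show ?thesis using q t unfolding sublinear_def by auto
qed

lemma tilt_le:
  assumes "sublinear q" "t \<ge> 0"
  shows "tilt q y x \<le> q (x + t *\<^sub>R y) - t * q y"
  unfolding tilt_def
  by (rule cINF_lower) (use assms in \<open>auto intro!: bdd_belowI2[of _ "- q (- x)"] tilt_bound\<close>)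

lemma sublinear_tilt:
  assumes q: "sublinear q"
  shows "sublinear (tilt q y)"
  unfolding sublinear_def
proof (intro conjI allI impI)
  have add: "q (u + v) \<le> q u + q v" for u v
    using q unfolding sublinear_def by auto
  fix u v
  have "tilt q y (u + v) \<le> (q (u + s *\<^sub>R y) - s * q y) + (q (v + t *\<^sub>R y) - t * q y)"
    if "s \<ge> 0" "t \<ge> 0" for s t
  proof -
    have "tilt q y (u + v) \<le> q (u + v + (s + t) *\<^sub>R y) - (s + t) * q y"
      using tilt_le[OF q, of "s + t"] that by simp
    also have "u + v + (s + t) *\<^sub>R y = (u + s *\<^sub>R y) + (v + t *\<^sub>R y)"
      by (simp add: algebra_simps)
    also have "q \<dots> - (s + t) * q y \<le> q (u + s *\<^sub>R y) + q (v + t *\<^sub>R y) - (s + t) * q y"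
      using add by simp
    finally show ?thesis by (simp add: algebra_simps)
  qed
  then have "tilt q y (u + v) - (q (v + t *\<^sub>R y) - t * q y) \<le> tilt q y u" if "t \<ge> 0" for t
    using that unfolding tilt_def[of q y u] by (intro cINF_greatest) (force simp: algebra_simps)+
  then have "tilt q y (u + v) - tilt q y u \<le> tilt q y v"
    unfolding tilt_def[of q y v] by (intro cINF_greatest) (force simp: algebra_simps)+
  then show "tilt q y (u + v) \<le> tilt q y u + tilt q y v" by simp
next
  have hom: "r \<ge> 0 \<Longrightarrow> q (r *\<^sub>R u) = r * q u" for u r
    using q unfolding sublinear_def by auto
  have le: "tilt q y (r *\<^sub>R x) \<le> r * tilt q y x" if r: "r > 0" for r x
  proof -
    have "tilt q y (r *\<^sub>R x) / r \<le> q (x + t *\<^sub>R y) - t * q y" if t: "t \<ge> 0" for t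
    proof -
      have "tilt q y (r *\<^sub>R x) \<le> q (r *\<^sub>R x + (r * t) *\<^sub>R y) - (r * t) * q y"
        by (rule tilt_le[OF q]) (use r t in simp)
      also have "r *\<^sub>R x + (r * t) *\<^sub>R y = r *\<^sub>R (x + t *\<^sub>R y)" by (simp add: algebra_simps)
      also have "q \<dots> = r * q (x + t *\<^sub>R y)" using r by (intro hom) simp
      finally show ?thesis using r by (simp add: field_simps)
    qed
    then have "tilt q y (r *\<^sub>R x) / r \<le> tilt q y x"
      unfolding tilt_def[of q y x] by (intro cINF_greatest) auto
    then show ?thesis using r by (simp add: field_simps)
  qed
  fix t :: real and x
  assume t: "t \<ge> 0"
  show "tilt q y (t *\<^sub>R x) = t * tilt q y x"
  proof (cases "t = 0")
    case True
    have "tilt q y 0 \<le> q (0 + 0 *\<^sub>R y) - 0 * q y" by (rule tilt_le[OF q]) simp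
    moreover have "0 \<le> tilt q y 0"
      unfolding tilt_def by (rule cINF_greatest) (auto simp: hom)
    ultimately show ?thesis using True sublinear_lower(2)[OF q] by simp
  next
    case False
    then have "t * tilt q y (inverse t *\<^sub>R t *\<^sub>R x) \<le> t * (inverse t * tilt q y (t *\<^sub>R x))"
      using t by (intro mult_left_mono le) auto
    then have "t * tilt q y x \<le> tilt q y (t *\<^sub>R x)" using False by (simp add: mult.assoc[symmetric])
    then show ?thesis using le[of t x] False t by simp
  qed
qed

text \<open>
  Minimality gives \<open>tilt q y = q\<close>, and the instance \<open>t = 1\<close> of the infimum is the missing inequality
  \<open>q x + q y \<le> q (x + y)\<close>.
\<close>

lemma minimal_sublinear_linear:
  assumes q: "sublinear q"
    and min: "\<And>r. sublinear r \<Longrightarrow> (\<forall>x. r x \<le> q x) \<Longrightarrow> r = q"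
  shows "q (x + y) = q x + q y"
proof -
  have "tilt q y u \<le> q u" for u using tilt_le[OF q, of 0] by simp
  then have "tilt q y = q" by (intro min sublinear_tilt q) simp
  then have "q x \<le> q (x + y) - q y" using tilt_le[OF q, of 1 y x] by simp
  moreover have "q (x + y) \<le> q x + q y" using q unfolding sublinear_def by auto
  ultimately show ?thesis by simp
qed

text \<open>
  Hahn-Banach in the form without subspaces: among the sublinear functionals below \<open>p\<close> Zorn's lemma
  yields a minimal one, since the pointwise infimum of a chain is again sublinear, and minimal
  sublinear functionals are linear.
\<close>

lemma linear_minorant:
  assumes p: "sublinear p"
  obtains f where "linear f" "\<And>x. f x \<le> p (x :: 'a::real_vector)"
proof -
  let ?A = "{q. sublinear q \<and> (\<forall>x. q x \<le> p x)}"
  let ?P = "\<lambda>q r. \<forall>x::'a. r x \<le> (q x :: real)"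
  have "\<exists>m\<in>?A. \<forall>a\<in>?A. ?P m a \<longrightarrow> a = m"
  proof (rule predicate_Zorn)
    show "partial_order_on ?A (relation_of ?P ?A)"
      by (intro partial_order_on_relation_ofI) (auto intro: order_trans simp: fun_eq_iff antisym)
  next
    fix C assume C: "C \<in> Chains (relation_of ?P ?A)"
    then have sub: "C \<subseteq> ?A" and chain: "\<And>q r. q \<in> C \<Longrightarrow> r \<in> C \<Longrightarrow> ?P q r \<or> ?P r q"
      unfolding Chains_def relation_of_def by auto
    show "\<exists>u\<in>?A. \<forall>a\<in>C. ?P a u"
    proof (cases "C = {}")
      case True
      then show ?thesis using p by auto
    next
      case False
      let ?u = "\<lambda>x. INF q\<in>C. q x"
      have bdd: "bdd_below ((\<lambda>q. q x) ` C)" for x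
      proof (rule bdd_belowI2[of _ "- p (- x)"])
        fix q assume "q \<in> C"
        then have "sublinear q" "q (- x) \<le> p (- x)" using sub by auto
        then show "- p (- x) \<le> q x" using sublinear_lower(1)[of q x] by linarith
      qed
      have low: "?u x \<le> q x" if "q \<in> C" for q x
        using cINF_lower[OF bdd that] .
      have "sublinear ?u"
        unfolding sublinear_def
      proof (intro conjI allI impI)
        fix x y
        have "?u (x + y) \<le> q x + r y" if qr: "q \<in> C" "r \<in> C" for q r
        proof -
          obtain s where s: "s \<in> C" "?P q s" "?P r s" using chain[OF qr] qr by blast
          have "?u (x + y) \<le> s (x + y)" by (rule low[OF s(1)])
          also have "\<dots> \<le> s x + s y" using s(1) sub unfolding sublinear_def by auto
          also have "\<dots> \<le> q x + r y" using s by (intro add_mono) auto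
          finally show ?thesis .
        qed
        then have "?u (x + y) - r y \<le> ?u x" if "r \<in> C" for r
          using that False by (intro cINF_greatest) (force simp: algebra_simps)+
        then have "?u (x + y) - ?u x \<le> ?u y"
          using False by (intro cINF_greatest) (force simp: algebra_simps)+
        then show "?u (x + y) \<le> ?u x + ?u y" by simp
      next
        fix t :: real and x assume "t \<ge> 0"
        have le: "?u (r *\<^sub>R x) \<le> r * ?u x" if "r > 0" for r x
        proof -
          have "?u (r *\<^sub>R x) / r \<le> ?u x"
          proof (rule cINF_greatest[OF False])
            fix q assume q: "q \<in> C"
            then have "q (r *\<^sub>R x) = r * q x" using sub that unfolding sublinear_def by auto
            then show "?u (r *\<^sub>R x) / r \<le> q x" using low[OF q, of "r *\<^sub>R x"] that by (simp add: field_simps)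
          qed
          then show ?thesis using that by (simp add: field_simps)
        qed
        show "?u (t *\<^sub>R x) = t * ?u x"
        proof (cases "t = 0")
          case True
          have "q 0 = 0" if "q \<in> C" for q using that sub sublinear_lower(2) by auto
          then have "(\<lambda>q. q 0) ` C = {0}" using False by force
          then show ?thesis using True by simp
        next
          case t: False
          then have "t * ?u (inverse t *\<^sub>R t *\<^sub>R x) \<le> t * (inverse t * ?u (t *\<^sub>R x))"
            using \<open>t \<ge> 0\<close> by (intro mult_left_mono le) auto
          then have "t * ?u x \<le> ?u (t *\<^sub>R x)" using t by (simp add: mult.assoc[symmetric])
          then show ?thesis using le[of t x] t \<open>t \<ge> 0\<close> by simp
        qed
      qed
      moreover have "?u x \<le> p x" for x
      proof -
        obtain q where "q \<in> C" using False by auto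
        then show ?thesis using low[of q x] sub by (auto intro: order_trans)
      qed
      ultimately show ?thesis using low by (intro bexI[of _ ?u]) auto
    qed
  qed
  then obtain q where q: "sublinear q" "\<And>x. q x \<le> p x"
    and min: "\<And>r. sublinear r \<Longrightarrow> (\<forall>x. r x \<le> q x) \<Longrightarrow> r = q"
    by (auto intro: order_trans) (metis order_trans)
  have add: "q (x + y) = q x + q y" for x y
    by (rule minimal_sublinear_linear[OF q(1) min])
  have neg: "q (- x) = - q x" for x
    using add[of x "- x"] sublinear_lower(2)[OF q(1)] by simp
  have "q (t *\<^sub>R x) = t * q x" for t x
  proof (cases "t \<ge> 0")
    case False
    then have "- t \<ge> 0" by simp
    then have "q ((- t) *\<^sub>R x) = (- t) * q x" using q(1) unfolding sublinear_def by blast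
    then show ?thesis using neg[of "t *\<^sub>R x"] by simp
  qed (use q(1) in \<open>auto simp: sublinear_def\<close>)
  then have "linear q" by (intro linearI) (simp_all add: add)
  then show thesis using q(2) that by blast
qed

text \<open>
  A real linear \<open>f\<close> below \<open>tilt norm x\<close> is bounded by the norm and satisfies \<open>f x \<ge> norm x\<close>;
  \<open>u \<mapsto> f u - \<i> f (\<i> u)\<close> is its complex linear extension.
\<close>

lemma cdual_separates:
  fixes x :: "'a::complex_normed_vector"
  assumes "\<And>\<phi>. cdual_apply \<phi> x = 0"
  shows "x = 0"
proof -
  have "sublinear (norm :: 'a \<Rightarrow> real)" by (simp add: sublinear_def norm_triangle_ineq)
  then obtain f where f: "linear f" "\<And>u. f u \<le> tilt norm x u"
    using linear_minorant[OF sublinear_tilt[of norm x]] by blast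
  have fn: "f u \<le> norm u" for u
    using f(2)[of u] tilt_le[OF \<open>sublinear norm\<close>, of 0 x u] by simp
  have fneg: "f (- u) = - f u" for u using f(1) by (rule linear_neg)
  have fx: "norm x \<le> f x"
    using f(2)[of "- x"] tilt_le[OF \<open>sublinear norm\<close>, of 1 x "- x"] fneg[of x] by simp
  have abs: "\<bar>f u\<bar> \<le> norm u" for u using fn[of u] fn[of "- u"] fneg[of u] by simp
  define g where "g u = Complex (f u) (- f (\<i> *\<^sub>C u))" for u
  have add: "f (u + v) = f u + f v" and diff: "f (u - v) = f u - f v"
    and hom: "f (r *\<^sub>R u) = r * f u" for u v r
    using f(1) by (simp_all add: linear_add linear_diff linear_scale)
  have "bounded_linear g"
  proof (rule bounded_linear_intro[where K = 2])
    fix u v and r :: real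
    show "g (u + v) = g u + g v"
      by (simp add: g_def complex_eq_iff add scaleC_add_right)
    show "g (r *\<^sub>R u) = r *\<^sub>R g u"
      by (simp add: g_def complex_eq_iff hom scaleC.scaleR_right)
    have "norm (g u) \<le> \<bar>f u\<bar> + \<bar>f (\<i> *\<^sub>C u)\<bar>"
      using cmod_le[of "g u"] by (simp add: g_def)
    also have "\<dots> \<le> norm u * 2" using abs[of u] abs[of "\<i> *\<^sub>C u"] by (simp add: norm_scaleC)
    finally show "norm (g u) \<le> norm u * 2" .
  qed
  moreover have "g (c *\<^sub>C u) = c *\<^sub>C g u" for c u
  proof -
    have "c *\<^sub>C v = Re c *\<^sub>R v + Im c *\<^sub>R \<i> *\<^sub>C v" for v :: 'a
    proof -
      have "c *\<^sub>C v = (complex_of_real (Re c) + complex_of_real (Im c) * \<i>) *\<^sub>C v"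
        using complex_eq[of c] by (simp add: mult.commute)
      then show ?thesis by (simp only: scaleC_add_left scaleR_scaleC scaleC_scaleC)
    qed
    note c = this
    show ?thesis
      unfolding g_def c[of u] scaleC_add_right scaleC.scaleR_right
      by (simp add: complex_eq_iff add diff hom scaleC_scaleC scaleC.minus_left scaleC_one fneg
          scaleC_complex_def)
  qed
  ultimately have "cdual_apply (cdual_of g) = g"
    by (intro cdual_apply_cdual_of) (simp add: bounded_clinear_iff)
  then have "g x = 0" using assms[of "cdual_of g"] by simp
  then show ?thesis using fx by (simp add: g_def complex_eq_iff)
qed

lemma bidual_embed_eq_zero: "bidual_embed x = 0 \<Longrightarrow> x = 0"
  by (rule cdual_separates) (metis cdual_apply_bidual_embed cdual_apply_zero_left)

section \<open>The Fourier coefficients of the absolute value of the sine\<close>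

text \<open>
  Up to a constant factor, the coefficient at \<open>2k + 1\<close> of the Fourier series of the sign of the sine.
\<close>

definition odd_recip :: "int \<Rightarrow> real"
  where "odd_recip k = 1 / (2 * of_int k + 1)"

lemma odd_nonzero: "2 * real_of_int k + 1 \<noteq> 0"
proof
  assume "2 * real_of_int k + 1 = 0"
  then have "real_of_int (2 * k + 1) = real_of_int 0" by simp
  then have "2 * k + 1 = 0" by (simp only: of_int_eq_iff)
  then show False by presburger
qed

lemma odd_recip_reflect: "odd_recip (- 1 - k) = - odd_recip k"
proof -
  have "2 * real_of_int (- 1 - k) + 1 = - (2 * real_of_int k + 1)" by simp
  then show ?thesis unfolding odd_recip_def by (simp only: divide_minus_right)
qed

lemma odd_recip_diff:
  "odd_recip j - odd_recip k = 2 * of_int (k - j) * (odd_recip j * odd_recip k)"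
proof -
  have "1 / a - 1 / b = (b - a) * (1 / a * (1 / b))" if "a \<noteq> 0" "b \<noteq> 0" for a b :: real
    using that by (simp add: field_simps)
  from this[OF odd_nonzero odd_nonzero, of j k] show ?thesis
    unfolding odd_recip_def by simp
qed

lemma UNIV_int_split: "(UNIV :: int set) = range int \<union> range (\<lambda>n. - 1 - int n)"
proof -
  have "k \<in> range (\<lambda>n. - 1 - int n)" if "k < 0" for k
    using that by (intro image_eqI[of _ _ "nat (- 1 - k)"]) auto
  moreover have "k \<in> range int" if "k \<ge> 0" for k
    using that by (intro image_eqI[of _ _ "nat k"]) auto
  ultimately show ?thesis by (metis UNIV_eq_I UnI1 UnI2 not_less)
qed

lemma summable_odd_recip_square: "(\<lambda>k. (odd_recip k)\<^sup>2) summable_on UNIV"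
proof -
  have "summable (\<lambda>n. 1 / real (Suc n) ^ 2)"
    using inverse_power_summable[of 2, where 'a = real] by (subst summable_Suc_iff) (simp add: field_simps)
  then have "summable (\<lambda>n. (odd_recip (int n))\<^sup>2)"
    by (rule summable_comparison_test'[where N = 0])
      (auto simp: odd_recip_def power_divide intro!: divide_left_mono power_mono)
  then have nat: "(\<lambda>n. (odd_recip (int n))\<^sup>2) summable_on UNIV"
    by (intro norm_summable_imp_summable_on) simp
  then have "(\<lambda>k. (odd_recip k)\<^sup>2) summable_on range int"
    by (subst summable_on_reindex) (auto simp: o_def)
  moreover have "(\<lambda>k. (odd_recip k)\<^sup>2) summable_on range (\<lambda>n. - 1 - int n)"
    using nat by (subst summable_on_reindex) (auto simp: o_def odd_recip_reflect inj_on_def)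
  ultimately show ?thesis
    unfolding UNIV_int_split by (intro summable_on_Un_disjoint) auto
qed

lemma has_sum_int_shift:
  fixes f :: "int \<Rightarrow> 'b::{comm_monoid_add,t2_space}"
  assumes "(f has_sum s) UNIV"
  shows "((\<lambda>k. f (k + m)) has_sum s) UNIV"
proof -
  have "bij_betw (\<lambda>k. k + m) UNIV UNIV" by (rule bij_betw_byWitness[where f' = "\<lambda>k. k - m"]) auto
  then show ?thesis using has_sum_reindex_bij_betw assms by blast
qed

lemma summable_on_int_shift:
  fixes f :: "int \<Rightarrow> 'b::{comm_monoid_add,t2_space}"
  assumes "f summable_on UNIV"
  shows "(\<lambda>k. f (k + m)) summable_on UNIV"
  using assms has_sum_int_shift unfolding summable_on_def by blast

lemma abs_summable_odd_recip_mult: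
  "(\<lambda>k. \<bar>odd_recip (k + p) * odd_recip (k + q)\<bar>) summable_on UNIV"
proof (rule summable_on_comparison_test)
  show "(\<lambda>k. (odd_recip (k + p))\<^sup>2 + (odd_recip (k + q))\<^sup>2) summable_on UNIV"
    by (intro summable_on_add summable_on_int_shift[where f = "\<lambda>k. (odd_recip k)\<^sup>2"]
        summable_odd_recip_square)
  fix k
  have "0 \<le> (\<bar>odd_recip (k + p)\<bar> - \<bar>odd_recip (k + q)\<bar>)\<^sup>2" by simp
  then have "2 * \<bar>odd_recip (k + p) * odd_recip (k + q)\<bar> \<le> (odd_recip (k + p))\<^sup>2 + (odd_recip (k + q))\<^sup>2"
    by (simp add: power2_diff abs_mult)
  then show "\<bar>odd_recip (k + p) * odd_recip (k + q)\<bar> \<le> (odd_recip (k + p))\<^sup>2 + (odd_recip (k + q))\<^sup>2"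
    using abs_ge_zero[of "odd_recip (k + p) * odd_recip (k + q)"] by linarith
qed simp

lemma summable_odd_recip_mult: "(\<lambda>k. odd_recip (k + p) * odd_recip (k + q)) summable_on UNIV"
  by (rule abs_summable_summable) (use abs_summable_odd_recip_mult[of p q] in simp)

lemma filterlim_int_intervals: "filterlim (\<lambda>N. {- int N..<int N}) (finite_subsets_at_top UNIV) sequentially"
  unfolding filterlim_finite_subsets_at_top
proof (intro allI impI, elim conjE)
  fix X :: "int set" assume "finite X"
  have b: "\<bar>x\<bar> \<le> Max (abs ` X)" if "x \<in> X" for x
    using \<open>finite X\<close> that by (intro Max_ge) auto
  have "X \<subseteq> {- int N..<int N}" if "N \<ge> nat (Max (abs ` X) + 1)" for N
  proof
    fix x assume "x \<in> X"
    then have "\<bar>x\<bar> < int N" using b[of x] that by linarith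
    then have "- int N < x" "x < int N" by linarith+
    then show "x \<in> {- int N..<int N}" by simp
  qed
  then show "\<forall>\<^sub>F N in sequentially. finite {- int N..<int N} \<and> X \<subseteq> {- int N..<int N} \<and> {- int N..<int N} \<subseteq> UNIV"
    by (intro eventually_sequentiallyI[of "nat (Max (abs ` X) + 1)"]) blast
qed

lemma has_sum_minus:
  fixes f g :: "'i \<Rightarrow> 'b::real_normed_vector"
  assumes "(f has_sum a) A" "(g has_sum b) A"
  shows "((\<lambda>k. f k - g k) has_sum (a - b)) A"
  using has_sum_add[OF assms(1), of "\<lambda>k. - g k" "- b"] assms(2) by (simp add: has_sum_uminus)

lemma has_sum_odd_recip_telescope: "((\<lambda>k. odd_recip k - odd_recip (k + 1)) has_sum 0) UNIV"
proof -
  let ?f = "\<lambda>k. odd_recip k - odd_recip (k + 1)"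
  have "?f k = 2 * (odd_recip (k + 0) * odd_recip (k + 1))" for k
    using odd_recip_diff[of k "k + 1"] by simp
  then have "?f summable_on UNIV"
    using summable_on_cmult_right[OF summable_odd_recip_mult[of 0 1], of 2] by simp
  then have s: "(?f has_sum infsum ?f UNIV) UNIV" by simp
  have "(\<lambda>N. sum ?f {- int N..<int N}) \<longlonglongrightarrow> infsum ?f UNIV"
    using filterlim_compose[OF s[unfolded has_sum_def] filterlim_int_intervals] .
  moreover have "sum ?f {- int N..<int N} = odd_recip (- int N) - odd_recip (int N)" for N
  proof (induction N)
    case (Suc N)
    have "{- int (Suc N)..<int (Suc N)} = insert (- int N - 1) (insert (int N) {- int N..<int N})" by auto
    then show ?case using Suc by (simp add: algebra_simps minus_diff_commute)
  qed simp
  moreover have "(\<lambda>N. odd_recip (- int N) - odd_recip (int N)) \<longlonglongrightarrow> 0"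
  proof -
    have "norm (odd_recip (int N)) \<le> norm (inverse (real (Suc N))) * 2" for N
      by (simp add: odd_recip_def field_simps)
    then have "(\<lambda>N. odd_recip (int N)) \<longlonglongrightarrow> 0"
      by (intro tendsto_0_le[OF LIMSEQ_inverse_real_of_nat, where K = 2] always_eventually) blast
    moreover have "norm (odd_recip (- int N)) \<le> norm (inverse (real (Suc N))) * 2" if "N \<ge> 1" for N
    proof -
      have "norm (odd_recip (- int N)) = 1 / (2 * real N - 1)"
        using odd_recip_reflect[of "int N - 1"] that by (simp add: odd_recip_def)
      also have "\<dots> \<le> norm (inverse (real (Suc N))) * 2"
        using that by (simp add: field_simps)
      finally show ?thesis .
    qed
    then have "(\<lambda>N. odd_recip (- int N)) \<longlonglongrightarrow> 0"
      by (intro tendsto_0_le[OF LIMSEQ_inverse_real_of_nat, where K = 2]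
          eventually_sequentiallyI[of 1]) blast
    ultimately show ?thesis using tendsto_diff by fastforce
  qed
  ultimately have "infsum ?f UNIV = 0" using LIMSEQ_unique by auto
  then show ?thesis using s by simp
qed

lemma has_sum_odd_recip_diff: "((\<lambda>k. odd_recip k - odd_recip (k + int m)) has_sum 0) UNIV"
proof (induction m)
  case (Suc m)
  have "((\<lambda>k. odd_recip (k + int m) - odd_recip (k + int m + 1)) has_sum 0) UNIV"
    using has_sum_int_shift[OF has_sum_odd_recip_telescope, of "int m"] .
  from has_sum_add[OF Suc this] show ?case by (simp add: algebra_simps)
qed simp

text \<open>
  The sign of the sine has square one; in terms of coefficients this is the orthogonality of the
  integer translates of \<open>odd_recip\<close>. The off-diagonal sums telescope by partial fractions.
\<close>

lemma odd_recip_orthogonal: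
  obtains K where "K > 0"
    "\<And>p q. ((\<lambda>k. odd_recip (k + p) * odd_recip (k + q)) has_sum (if p = q then K else 0)) UNIV"
proof
  let ?K = "infsum (\<lambda>k. (odd_recip k)\<^sup>2) UNIV"
  have K: "((\<lambda>k. (odd_recip k)\<^sup>2) has_sum ?K) UNIV" using summable_odd_recip_square by simp
  have "sum (\<lambda>k. (odd_recip k)\<^sup>2) {0} \<le> ?K"
    by (rule finite_sum_le_infsum[OF summable_odd_recip_square]) auto
  then show "?K > 0" by (simp add: odd_recip_def)
  have pos: "((\<lambda>k. odd_recip (k + p) * odd_recip (k + (p + int m))) has_sum 0) UNIV" if "m > 0" for p m
  proof -
    have "odd_recip k * odd_recip (k + int m) = (1 / (2 * real m)) * (odd_recip k - odd_recip (k + int m))" for k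
      using odd_recip_diff[of k "k + int m"] that by simp
    then have "((\<lambda>k. odd_recip k * odd_recip (k + int m)) has_sum 0) UNIV"
      using has_sum_cmult_right[OF has_sum_odd_recip_diff[of m], of "1 / (2 * real m)"] by simp
    from has_sum_int_shift[OF this, of p] show ?thesis by (simp add: algebra_simps)
  qed
  fix p q :: int
  consider "p = q" | "p < q" | "q < p" using linorder_cases[of p q] by blast
  then show "((\<lambda>k. odd_recip (k + p) * odd_recip (k + q)) has_sum (if p = q then ?K else 0)) UNIV"
  proof cases
    case 1
    then show ?thesis using has_sum_int_shift[OF K, of p] by (simp add: power2_eq_square)
  next
    case 2
    then show ?thesis using pos[of "nat (q - p)" p] by simp
  next
    case 3
    then show ?thesis using pos[of "nat (p - q)" q] by (simp add: mult.commute)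
  qed
qed

text \<open>
  This is \<open>1 / (1 - 4k\<^sup>2)\<close>, the coefficient at \<open>2k\<close> of the Fourier series of \<open>(\<pi>/2) \<bar>sin\<bar>\<close>. The form
  chosen here displays it as the product of the sine with its sign.
\<close>

definition abs_sin_coeff :: "int \<Rightarrow> real"
  where "abs_sin_coeff k = (odd_recip k - odd_recip (k - 1)) / 2"

lemma abs_sin_coeff_values [simp]:
  "abs_sin_coeff 0 = 1" "abs_sin_coeff 1 = - 1 / 3"
  by (simp_all add: abs_sin_coeff_def odd_recip_def)

lemma abs_summable_abs_sin_coeff: "(\<lambda>k. \<bar>abs_sin_coeff k\<bar>) summable_on UNIV"
proof -
  have "abs_sin_coeff k = - (odd_recip (k + 0) * odd_recip (k + - 1))" for k
    using odd_recip_diff[of k "k - 1"] by (simp add: abs_sin_coeff_def)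
  then show ?thesis using abs_summable_odd_recip_mult[of 0 "- 1"] by simp
qed

text \<open>
  The identity \<open>\<bar>sin\<bar>\<^sup>2 = sin\<^sup>2\<close> in terms of coefficients: the right-hand side has only the frequencies
  \<open>0\<close> and \<open>\<plusminus>2\<close>, with weights in the ratio \<open>2 : -1\<close>.
\<close>

lemma abs_sin_coeff_convolution:
  obtains K where "K > 0"
    "\<And>n. ((\<lambda>k. abs_sin_coeff k * abs_sin_coeff (n - k)) has_sum
       (if n = 0 then K / 2 else if n = 1 \<or> n = - 1 then - K / 4 else 0)) UNIV"
proof -
  obtain K where K: "K > 0"
    "\<And>p q. ((\<lambda>k. odd_recip (k + p) * odd_recip (k + q)) has_sum (if p = q then K else 0)) UNIV"
    by (rule odd_recip_orthogonal) blast
  let ?e = "\<lambda>p q. if p = q then K else 0"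
  have "((\<lambda>k. abs_sin_coeff k * abs_sin_coeff (n - k)) has_sum
       (if n = 0 then K / 2 else if n = 1 \<or> n = - 1 then - K / 4 else 0)) UNIV" for n
  proof -
    have refl: "odd_recip (n - k) = - odd_recip (k + (- n - 1))"
      "odd_recip (n - k - 1) = - odd_recip (k + - n)" for k
      using odd_recip_reflect[of "k - n - 1"] odd_recip_reflect[of "k - n"] by (simp_all add: algebra_simps)
    have "abs_sin_coeff k * abs_sin_coeff (n - k) =
      1 / 4 * ((odd_recip (k + 0) * odd_recip (k + - n) - odd_recip (k + 0) * odd_recip (k + (- n - 1)))
        + (odd_recip (k + - 1) * odd_recip (k + (- n - 1)) - odd_recip (k + - 1) * odd_recip (k + - n)))" for k
      unfolding abs_sin_coeff_def refl by (simp add: field_simps)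
    moreover have "((\<lambda>k. 1 / 4 * ((odd_recip (k + 0) * odd_recip (k + - n) - odd_recip (k + 0) * odd_recip (k + (- n - 1)))
        + (odd_recip (k + - 1) * odd_recip (k + (- n - 1)) - odd_recip (k + - 1) * odd_recip (k + - n)))) has_sum
        1 / 4 * ((?e 0 (- n) - ?e 0 (- n - 1)) + (?e (- 1) (- n - 1) - ?e (- 1) (- n)))) UNIV"
      by (intro has_sum_cmult_right has_sum_add has_sum_minus K(2))
    moreover have "1 / 4 * ((?e 0 (- n) - ?e 0 (- n - 1)) + (?e (- 1) (- n - 1) - ?e (- 1) (- n))) =
      (if n = 0 then K / 2 else if n = 1 \<or> n = - 1 then - K / 4 else 0)"
      by auto
    ultimately show ?thesis by (simp only:)
  qed
  then show thesis using K(1) that by blast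
qed

lemma cis_geometric_sum:
  assumes "Q > 0" and "\<bar>k\<bar> < int Q" and "k \<noteq> 0"
  shows "(\<Sum>r<Q. cis (2 * pi * real r / real Q * of_int k)) = 0"
proof -
  let ?z = "cis (2 * pi * of_int k / real Q)"
  have "?z \<noteq> 1"
  proof
    assume "?z = 1"
    then have "cos (2 * pi * of_int k / real Q) = 1" by (simp add: complex_eq_iff)
    then obtain n :: int where "2 * pi * of_int k / real Q = of_int n * (2 * pi)"
      using cos_one_2pi_int by auto
    then have "real_of_int k = of_int (n * int Q)" using assms by (simp add: field_simps)
    then have "k = n * int Q" by (simp only: of_int_eq_iff)
    then show False using assms by (auto simp: abs_mult zero_less_mult_iff mult_less_cancel_right1)
  qed
  moreover have "?z ^ Q = 1"
  proof -
    have "?z ^ Q = cis (real Q * (2 * pi * of_int k / real Q))" by (rule Complex.DeMoivre)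
    also have "real Q * (2 * pi * of_int k / real Q) = 2 * pi * of_int k" using assms(1) by simp
    also have "cis \<dots> = 1" by (rule cis_multiple_2pi) (rule Ints_of_int)
    finally show ?thesis .
  qed
  moreover have "cis (2 * pi * real r / real Q * of_int k) = ?z ^ r" for r
    by (simp add: Complex.DeMoivre mult_ac)
  ultimately show ?thesis by (simp add: sum_gp_strict)
qed

lemma has_sum_finite_sum:
  fixes f :: "'j \<Rightarrow> 'i \<Rightarrow> 'b::topological_comm_monoid_add"
  assumes "finite J" and "\<And>j. j \<in> J \<Longrightarrow> (f j has_sum s j) A"
  shows "((\<lambda>i. \<Sum>j\<in>J. f j i) has_sum (\<Sum>j\<in>J. s j)) A"
  using assms by (induction J rule: finite_induct) (auto intro: has_sum_add)

text \<open>
  Averaging over the \<open>Q\<close>-th roots of unity multiplies the coefficient at \<open>k\<close> by a factor which is \<open>1\<close> at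
  \<open>k = 0\<close>, zero for \<open>0 < \<bar>k\<bar> < Q\<close> and at most \<open>1\<close> in modulus elsewhere. So the coefficient at \<open>0\<close> is
  controlled by a tail of an absolutely convergent series.
\<close>

lemma fourier_coefficient_zero:
  fixes G :: "int \<Rightarrow> 'x::complex_banach"
  assumes summable: "(\<lambda>k. norm (G k)) summable_on UNIV"
    and zero: "\<And>t. ((\<lambda>k. cis (t * of_int k) *\<^sub>C G k) has_sum 0) UNIV"
  shows "G 0 = 0"
proof -
  have "norm (G 0) \<le> e" if "e > 0" for e
  proof -
    let ?N = "\<lambda>k. norm (G k)"
    obtain S where S: "finite S" "dist (sum ?N S) (infsum ?N UNIV) \<le> e"
      using infsum_finite_approximation[OF summable \<open>e > 0\<close>] by auto
    \<comment> \<open>\<open>Q\<close> exceeds every frequency in \<open>S\<close>, outside of which the series is small.\<close>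
    define Q where "Q = Suc (nat (Max (insert 0 (abs ` S))))"
    have Q: "\<bar>k\<bar> < int Q" if "k \<in> S" for k
    proof -
      have "\<bar>k\<bar> \<le> Max (insert 0 (abs ` S))" using S(1) that by (intro Max_ge) auto
      then show ?thesis unfolding Q_def by linarith
    qed
    define \<rho> where "\<rho> k = (\<Sum>r<Q. cis (2 * pi * real r / real Q * of_int k)) / of_nat Q" for k
    have Q0: "of_nat Q \<noteq> (0 :: complex)" unfolding Q_def by (simp only: of_nat_eq_0_iff)
    then have \<rho>0: "\<rho> 0 = 1" by (simp add: \<rho>_def)
    have \<rho>S: "\<rho> k = 0" if "k \<in> S" "k \<noteq> 0" for k
      using cis_geometric_sum[of Q k] Q[OF that(1)] that by (simp add: \<rho>_def Q_def)
    have \<rho>1: "cmod (\<rho> k) \<le> 1" for k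
    proof -
      have "cmod (\<Sum>r<Q. cis (2 * pi * real r / real Q * of_int k)) \<le> (\<Sum>r<Q. 1)"
        by (rule order_trans[OF norm_sum]) (rule sum_mono, simp only: norm_cis order_refl)
      also have "(\<Sum>r<Q. 1) = real Q" by simp
      finally have le: "cmod (\<Sum>r<Q. cis (2 * pi * real r / real Q * of_int k)) \<le> real Q" .
      have "real Q > 0" unfolding Q_def by (simp only: of_nat_0_less_iff)
      then show ?thesis
        unfolding \<rho>_def norm_divide norm_of_nat using le by (simp only: divide_le_eq_1_pos)
    qed
    have "((\<lambda>k. \<Sum>r<Q. cis (2 * pi * real r / real Q * of_int k) *\<^sub>C G k) has_sum (\<Sum>r<Q. 0)) UNIV"
      by (rule has_sum_finite_sum, simp, rule zero)
    from has_sum_bounded_linear[OF scaleC.bounded_linear_right this, of "1 / of_nat Q"]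
    have "((\<lambda>k. (1 / of_nat Q) *\<^sub>C (\<Sum>r<Q. cis (2 * pi * real r / real Q * of_int k)) *\<^sub>C G k)
        has_sum (1 / of_nat Q) *\<^sub>C 0) UNIV"
      by (simp only: scaleC.sum_left sum.neutral_const)
    then have "((\<lambda>k. \<rho> k *\<^sub>C G k) has_sum 0) UNIV"
      by (simp add: scaleC_scaleC scaleC.zero_right \<rho>_def)
    moreover have "((\<lambda>k. if k = 0 then G 0 else 0) has_sum G 0) UNIV"
      by (rule has_sum_finite_neutralI[of "{0}"]) auto
    ultimately have tail: "((\<lambda>k. \<rho> k *\<^sub>C G k - (if k = 0 then G 0 else 0)) has_sum (0 - G 0)) UNIV"
      by (rule has_sum_minus)
    have "((\<lambda>k. if k \<in> S then ?N k else 0) has_sum sum ?N S) UNIV"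
      by (rule has_sum_finite_neutralI[OF S(1)]) auto
    from has_sum_minus[OF has_sum_infsum[OF summable] this]
    have rest: "((\<lambda>k. ?N k - (if k \<in> S then ?N k else 0)) has_sum (infsum ?N UNIV - sum ?N S)) UNIV" .
    have "norm (0 - G 0) \<le> infsum ?N UNIV - sum ?N S"
    proof (rule norm_infsum_le[OF tail rest])
      fix k
      have "norm (\<rho> k *\<^sub>C G k) \<le> ?N k"
        using mult_right_mono[OF \<rho>1[of k], of "norm (G k)"] by (simp add: norm_scaleC)
      then show "norm (\<rho> k *\<^sub>C G k - (if k = 0 then G 0 else 0)) \<le> ?N k - (if k \<in> S then ?N k else 0)"
        using \<rho>S[of k] by (auto simp: \<rho>0 scaleC_one scaleC.zero_left)
    qed
    also have "\<dots> \<le> e" using S(2) by (simp add: dist_real_def)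
    finally show ?thesis by simp
  qed
  then show ?thesis using field_le_epsilon[of "norm (G 0)" 0] by auto
qed

section \<open>Bilinear maps annihilating zero products\<close>

lemma has_sum_bilinear_product:
  fixes b :: "'a::banach \<Rightarrow> 'b::banach \<Rightarrow> 'c::banach"
  assumes b: "bounded_bilinear b"
    and u: "(\<lambda>j. norm (u j)) summable_on I" and v: "(\<lambda>k. norm (v k)) summable_on J"
  shows "((\<lambda>(j, k). b (u j) (v k)) has_sum b (infsum u I) (infsum v J)) (I \<times> J)"
proof -
  interpret b: bounded_bilinear b by (rule b)
  obtain C where C: "C \<ge> 0" "\<And>x y. norm (b x y) \<le> norm x * norm y * C"
    using b.nonneg_bounded by blast
  have su: "u summable_on I" and sv: "v summable_on J"
    by (rule abs_summable_summable, rule u, rule abs_summable_summable, rule v)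
  have "(\<lambda>(j, k). norm (u j) * norm (v k) * C) summable_on I \<times> J"
  proof (rule summable_on_SigmaI)
    fix j
    show "((\<lambda>k. case (j, k) of (j, k) \<Rightarrow> norm (u j) * norm (v k) * C) has_sum
        norm (u j) * (infsum (\<lambda>k. norm (v k)) J * C)) J"
      using v by (auto simp: mult.assoc intro!: has_sum_cmult_right has_sum_cmult_left)
    show "(\<lambda>j. norm (u j) * (infsum (\<lambda>k. norm (v k)) J * C)) summable_on I"
      using u by (intro summable_on_cmult_left)
  qed (use C in auto)
  then have "(\<lambda>p. norm (case p of (j, k) \<Rightarrow> b (u j) (v k))) summable_on I \<times> J"
    by (rule summable_on_comparison_test) (use C in auto)
  then have "(\<lambda>(j, k). b (u j) (v k)) summable_on I \<times> J" by (rule abs_summable_summable)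
  then have s: "((\<lambda>(j, k). b (u j) (v k)) has_sum infsum (\<lambda>(j, k). b (u j) (v k)) (I \<times> J)) (I \<times> J)"
    by simp
  have "((\<lambda>j. b (u j) (infsum v J)) has_sum infsum (\<lambda>(j, k). b (u j) (v k)) (I \<times> J)) I"
    by (rule has_sum_SigmaD[OF s])
      (simp only: prod.case, rule has_sum_bounded_linear[OF b.bounded_linear_right has_sum_infsum[OF sv]])
  moreover have "((\<lambda>j. b (u j) (infsum v J)) has_sum b (infsum u I) (infsum v J)) I"
    using su by (rule has_sum_bounded_linear[OF b.bounded_linear_left has_sum_infsum])
  ultimately show ?thesis using s has_sum_unique by metis
qed

text \<open>
  For \<open>x j = av\<^sup>j\<close> with \<open>v = exp(i\<theta>)\<close> this is \<open>a\<close> times \<open>(\<pi>/2) \<bar>sin \<theta>\<bar>\<close>.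
\<close>

definition abs_sin_series :: "(int \<Rightarrow> 'a::real_normed_vector) \<Rightarrow> 'a"
  where "abs_sin_series x = (\<Sum>\<^sub>\<infinity>k. abs_sin_coeff k *\<^sub>R x (2 * k))"

lemma abs_summable_abs_sin_series:
  assumes "\<And>j. norm (x j) \<le> B"
  shows "(\<lambda>k. norm (abs_sin_coeff k *\<^sub>R x (f k))) summable_on UNIV"
proof (rule summable_on_comparison_test)
  show "(\<lambda>k. \<bar>abs_sin_coeff k\<bar> * B) summable_on UNIV"
    by (intro summable_on_cmult_left abs_summable_abs_sin_coeff)
qed (use assms in \<open>auto intro: mult_left_mono\<close>)

lemma has_sum_abs_sin_series:
  fixes x :: "int \<Rightarrow> 'a::banach"
  assumes "\<And>j. norm (x j) \<le> B"
  shows "((\<lambda>k. abs_sin_coeff k *\<^sub>R x (2 * k)) has_sum abs_sin_series x) UNIV"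
  unfolding abs_sin_series_def
  by (rule has_sum_infsum, rule abs_summable_summable, rule abs_summable_abs_sin_series[OF assms])

text \<open>
  The hypothesis \<open>x j * y k = z (j + k)\<close> is what remains of \<open>x j = av\<^sup>j\<close> and \<open>y k = v\<^sup>kc\<close>; it makes the
  product of two series a convolution.
\<close>

lemma abs_sin_series_square:
  obtains K where "K > 0"
    "\<And>(x :: int \<Rightarrow> 'a::{real_normed_algebra,banach}) y z B.
      (\<And>j. norm (x j) \<le> B) \<Longrightarrow> (\<And>j. norm (y j) \<le> B) \<Longrightarrow> (\<And>j k. x j * y k = z (j + k)) \<Longrightarrow>
      abs_sin_series x * abs_sin_series y = (K / 4) *\<^sub>R (2 *\<^sub>R z 0 - z 2 - z (- 2))"
proof -
  obtain K where K: "K > 0"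
    "\<And>n. ((\<lambda>k. abs_sin_coeff k * abs_sin_coeff (n - k)) has_sum
       (if n = 0 then K / 2 else if n = 1 \<or> n = - 1 then - K / 4 else 0)) UNIV"
    by (rule abs_sin_coeff_convolution) blast
  have "abs_sin_series x * abs_sin_series y = (K / 4) *\<^sub>R (2 *\<^sub>R z 0 - z 2 - z (- 2))"
    if x: "\<And>j. norm (x j) \<le> B" and y: "\<And>j. norm (y j) \<le> B" and z: "\<And>j k. x j * y k = z (j + k)"
    for x y z :: "int \<Rightarrow> 'a::{real_normed_algebra,banach}" and B
  proof -
    let ?c = "\<lambda>n. if n = 0 then K / 2 else if n = 1 \<or> n = - 1 then - K / 4 else 0"
    have "((\<lambda>(j, k). (abs_sin_coeff j *\<^sub>R x (2 * j)) * (abs_sin_coeff k *\<^sub>R y (2 * k))) has_sum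
        abs_sin_series x * abs_sin_series y) (UNIV \<times> UNIV)"
      unfolding abs_sin_series_def
      by (rule has_sum_bilinear_product[OF bounded_bilinear_mult
            abs_summable_abs_sin_series[OF x] abs_summable_abs_sin_series[OF y]])
    then have "((\<lambda>(j, k). (abs_sin_coeff j * abs_sin_coeff k) *\<^sub>R z (2 * (j + k))) has_sum
        abs_sin_series x * abs_sin_series y) (UNIV \<times> UNIV)"
      by (simp add: z distrib_left mult.commute)
    also have "?this \<longleftrightarrow> ((\<lambda>(n, k). (abs_sin_coeff k * abs_sin_coeff (n - k)) *\<^sub>R z (2 * n)) has_sum
        abs_sin_series x * abs_sin_series y) (UNIV \<times> UNIV)"
      by (rule has_sum_reindex_bij_witness[where i = "\<lambda>(n, k). (k, n - k)" and j = "\<lambda>(j, k). (j + k, j)"])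
        auto
    finally have s: "((\<lambda>(n, k). (abs_sin_coeff k * abs_sin_coeff (n - k)) *\<^sub>R z (2 * n)) has_sum
        abs_sin_series x * abs_sin_series y) (UNIV \<times> UNIV)" .
    have "((\<lambda>k. (abs_sin_coeff k * abs_sin_coeff (n - k)) *\<^sub>R z (2 * n)) has_sum ?c n *\<^sub>R z (2 * n)) UNIV" for n
      by (rule has_sum_bounded_linear[OF bounded_linear_scaleR_left K(2)])
    note inner = this
    have total: "((\<lambda>n. ?c n *\<^sub>R z (2 * n)) has_sum abs_sin_series x * abs_sin_series y) UNIV"
      by (rule has_sum_SigmaD[OF s]) (simp only: prod.case inner)
    have "((\<lambda>n. ?c n *\<^sub>R z (2 * n)) has_sum (\<Sum>n\<in>{0, 1, - 1}. ?c n *\<^sub>R z (2 * n))) UNIV"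
      by (rule has_sum_finite_neutralI[of "{0, 1, - 1}"]) auto
    from has_sum_unique[OF total this]
    show ?thesis by (simp add: scaleR_diff_right)
  qed
  then show thesis by (rule that[OF K(1)])
qed

text \<open>
  Let \<open>A\<close> be the series for \<open>\<bar>sin\<bar>\<close> and \<open>B\<close> the multiple of \<open>x 1 - x (-1)\<close> that plays the sine. Then
  \<open>(A + B)(A - B) = 0\<close> and \<open>(A - B)(A + B) = 0\<close>, the left factors being formed from \<open>x\<close> and the right
  ones from \<open>y\<close>, and the difference of the two resulting equations for \<open>\<phi>\<close> is \<open>2\<phi>(B,A) = 2\<phi>(A,B)\<close>.
\<close>

lemma zero_product_antisymmetry:
  fixes x y z :: "int \<Rightarrow> 'a::{complex_normed_algebra, complex_banach}"
    and \<phi> :: "'a \<Rightarrow> 'a \<Rightarrow> 'x::complex_banach"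
  assumes \<phi>: "bounded_bilinear \<phi>"
    and left: "\<And>c a b. \<phi> (c *\<^sub>C a) b = c *\<^sub>C \<phi> a b"
    and right: "\<And>c a b. \<phi> a (c *\<^sub>C b) = c *\<^sub>C \<phi> a b"
    and zero: "\<And>a b. a * b = 0 \<Longrightarrow> \<phi> a b = 0"
    and x: "\<And>j. norm (x j) \<le> B" and y: "\<And>j. norm (y j) \<le> B"
    and z: "\<And>j k. x j * y k = z (j + k)"
  shows "\<phi> (x 1 - x (- 1)) (abs_sin_series y) = \<phi> (abs_sin_series x) (y 1 - y (- 1))"
proof -
  interpret \<phi>: bounded_bilinear \<phi> by (rule \<phi>)
  obtain K where "K > 0" and K: "\<And>(x :: int \<Rightarrow> 'a) y z B.
      (\<And>j. norm (x j) \<le> B) \<Longrightarrow> (\<And>j. norm (y j) \<le> B) \<Longrightarrow> (\<And>j k. x j * y k = z (j + k)) \<Longrightarrow>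
      abs_sin_series x * abs_sin_series y = (K / 4) *\<^sub>R (2 *\<^sub>R z 0 - z 2 - z (- 2))"
    using abs_sin_series_square[where 'a = 'a] by metis
  \<comment> \<open>The sine is the difference of the exponentials times an imaginary constant, chosen here so that its square equals that of the series.\<close>
  define s where "s = \<i> * complex_of_real (sqrt (K / 4))"
  have s2: "s * s = - complex_of_real (K / 4)"
  proof -
    have "complex_of_real (sqrt (K / 4)) * complex_of_real (sqrt (K / 4)) = complex_of_real (K / 4)"
      using \<open>K > 0\<close> by (simp flip: of_real_mult)
    then show ?thesis unfolding s_def by (simp add: algebra_simps)
  qed
  have "s \<noteq> 0" using \<open>K > 0\<close> by (simp add: s_def)
  define Ax where "Ax = abs_sin_series x"
  define Ay where "Ay = abs_sin_series y"
  define Bx where "Bx = x 1 - x (- 1)"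
  define By where "By = y 1 - y (- 1)"
  have AA: "Ax * Ay = (K / 4) *\<^sub>R (2 *\<^sub>R z 0 - z 2 - z (- 2))"
    unfolding Ax_def Ay_def by (rule K[of x B y z, OF x y z])
  have BB: "(s *\<^sub>C Bx) * (s *\<^sub>C By) = Ax * Ay"
  proof -
    have "Bx * By = - (2 *\<^sub>R z 0 - z 2 - z (- 2))"
      unfolding Bx_def By_def by (simp add: left_diff_distrib right_diff_distrib z scaleR_2)
    then have "(s *\<^sub>C Bx) * (s *\<^sub>C By) = (s * s) *\<^sub>C (- (2 *\<^sub>R z 0 - z 2 - z (- 2)))"
      by (simp only: mult_scaleC_left mult_scaleC_right scaleC_scaleC)
    then show ?thesis
      unfolding AA s2 by (simp only: scaleR_scaleC[of "K / 4"] scaleC.minus_left scaleC.minus_right minus_minus)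
  qed
  have Ax: "((\<lambda>k. abs_sin_coeff k *\<^sub>R x (2 * k)) has_sum Ax) UNIV"
    unfolding Ax_def by (rule has_sum_abs_sin_series[OF x])
  have Ay: "((\<lambda>k. abs_sin_coeff k *\<^sub>R y (2 * k)) has_sum Ay) UNIV"
    unfolding Ay_def by (rule has_sum_abs_sin_series[OF y])
  have "((\<lambda>k. (abs_sin_coeff k *\<^sub>R x (2 * k)) * By) has_sum Ax * By) UNIV"
    by (rule has_sum_bounded_linear[OF bounded_linear_mult_left Ax])
  moreover have "((\<lambda>k. Bx * (abs_sin_coeff k *\<^sub>R y (2 * k))) has_sum Bx * Ay) UNIV"
    by (rule has_sum_bounded_linear[OF bounded_linear_mult_right Ay])
  moreover have "(abs_sin_coeff k *\<^sub>R x (2 * k)) * By = Bx * (abs_sin_coeff k *\<^sub>R y (2 * k))" for k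
    by (simp add: Bx_def By_def left_diff_distrib right_diff_distrib scaleR_diff_right z add.commute)
  ultimately have AB: "Ax * By = Bx * Ay" using has_sum_unique by (simp only:) blast
  have comm: "Ax * (s *\<^sub>C By) = (s *\<^sub>C Bx) * Ay"
    by (simp add: mult_scaleC_left mult_scaleC_right AB)
  have "(Ax + s *\<^sub>C Bx) * (Ay - s *\<^sub>C By) = 0"
    unfolding distrib_right right_diff_distrib BB comm by simp
  from zero[OF this] have 1: "\<phi> Ax Ay - s *\<^sub>C \<phi> Ax By + s *\<^sub>C \<phi> Bx Ay - s *\<^sub>C s *\<^sub>C \<phi> Bx By = 0"
    by (simp add: \<phi>.add_left \<phi>.diff_right left right algebra_simps scaleC_add_right scaleC.diff_right)
  have "(Ax - s *\<^sub>C Bx) * (Ay + s *\<^sub>C By) = 0"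
    unfolding distrib_left left_diff_distrib BB comm by simp
  from zero[OF this] have 2: "\<phi> Ax Ay + s *\<^sub>C \<phi> Ax By - s *\<^sub>C \<phi> Bx Ay - s *\<^sub>C s *\<^sub>C \<phi> Bx By = 0"
    by (simp add: \<phi>.add_right \<phi>.diff_left left right algebra_simps scaleC_add_right scaleC.diff_right)
  have "2 *\<^sub>R s *\<^sub>C \<phi> Bx Ay = 2 *\<^sub>R s *\<^sub>C \<phi> Ax By"
    using arg_cong2[OF 1 2, of "(-)"] by (simp add: scaleR_2 algebra_simps)
  then have "s *\<^sub>C \<phi> Bx Ay = s *\<^sub>C \<phi> Ax By" by simp
  then have "\<phi> Bx Ay = \<phi> Ax By" by (rule scaleC_cancel_left) fact
  then show ?thesis unfolding Ax_def Ay_def Bx_def By_def .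
qed

lemma cis_scaleC_cis: "cis a *\<^sub>C cis b *\<^sub>C v = cis (a + b) *\<^sub>C v"
  by (simp add: scaleC_scaleC cis_mult)

text \<open>
  Multiplying \<open>x j\<close> and \<open>y j\<close> by \<open>exp(ij\<tau>)\<close> respects all hypotheses, so the preceding identity holds with
  the free parameter \<open>\<tau>\<close>. Both sides are Fourier series in \<open>\<tau>\<close>; the coefficients at the frequency \<open>1\<close>,
  where the weights of the absolute sine are \<open>1\<close> and \<open>-1/3\<close>, give the third difference of
  \<open>n \<mapsto> \<phi>(x n, y (1 - n))\<close> at \<open>n = -1\<close>.
\<close>

lemma zero_product_third_difference:
  fixes x y z :: "int \<Rightarrow> 'a::{complex_normed_algebra, complex_banach}"
    and \<phi> :: "'a \<Rightarrow> 'a \<Rightarrow> 'x::complex_banach"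
  assumes \<phi>: "bounded_bilinear \<phi>"
    and left: "\<And>c a b. \<phi> (c *\<^sub>C a) b = c *\<^sub>C \<phi> a b"
    and right: "\<And>c a b. \<phi> a (c *\<^sub>C b) = c *\<^sub>C \<phi> a b"
    and zero: "\<And>a b. a * b = 0 \<Longrightarrow> \<phi> a b = 0"
    and x: "\<And>j. norm (x j) \<le> B" and y: "\<And>j. norm (y j) \<le> B"
    and z: "\<And>j k. x j * y k = z (j + k)"
  shows "3 *\<^sub>R (\<phi> (x 1) (y 0) - \<phi> (x 0) (y 1)) = \<phi> (x 2) (y (- 1)) - \<phi> (x (- 1)) (y 2)"
proof -
  interpret \<phi>: bounded_bilinear \<phi> by (rule \<phi>)
  obtain C where C: "C \<ge> 0" "\<And>a b. norm (\<phi> a b) \<le> norm a * norm b * C"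
    using \<phi>.nonneg_bounded by blast
  have B: "B \<ge> 0" using x[of 0] norm_ge_zero order_trans by blast
  define \<psi> where "\<psi> j k = \<phi> (x j) (y k) - \<phi> (x k) (y j)" for j k
  have \<psi>: "norm (\<psi> j k) \<le> 2 * (B * B * C)" for j k
  proof -
    have "norm (\<phi> (x j) (y k)) \<le> B * B * C" for j k
      using C(2)[of "x j" "y k"] mult_right_mono[OF mult_mono[OF x[of j] y[of k] B norm_ge_zero] C(1)]
      by linarith
    from this[of j k] this[of k j] show ?thesis
      unfolding \<psi>_def using norm_triangle_ineq4[of "\<phi> (x j) (y k)" "\<phi> (x k) (y j)"] by linarith
  qed
  define u where "u k = abs_sin_coeff k *\<^sub>R \<psi> 1 (2 * k)" for k
  define w where "w k = abs_sin_coeff k *\<^sub>R \<psi> (- 1) (2 * k)" for k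
  have su: "(\<lambda>k. norm (u k)) summable_on UNIV" and sw: "(\<lambda>k. norm (w k)) summable_on UNIV"
    unfolding u_def w_def
    by (rule abs_summable_abs_sin_series[where B = "2 * (B * B * C)"], rule \<psi>)+
  have sw1: "(\<lambda>k. norm (w (k + 1))) summable_on UNIV"
    using summable_on_int_shift[OF sw, of 1] .
  have "((\<lambda>k. cis (t * of_int k) *\<^sub>C (u k - w (k + 1))) has_sum 0) UNIV" for t
  proof -
    \<comment> \<open>Only even frequencies survive after the multiplication by \<open>cis (- \<tau>)\<close> below, hence the half angle.\<close>
    define \<tau> where "\<tau> = t / 2"
    define x' where "x' j = cis (of_int j * \<tau>) *\<^sub>C x j" for j
    define y' where "y' j = cis (of_int j * \<tau>) *\<^sub>C y j" for j
    define z' where "z' j = cis (of_int j * \<tau>) *\<^sub>C z j" for j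
    have x': "norm (x' j) \<le> B" and y': "norm (y' j) \<le> B" for j
      using x y by (simp_all add: x'_def y'_def norm_scaleC)
    have z': "x' j * y' k = z' (j + k)" for j k
      unfolding x'_def y'_def z'_def
      by (simp add: mult_scaleC_left mult_scaleC_right cis_scaleC_cis z distrib_right add.commute)
    have "((\<lambda>k. \<phi> (x' 1 - x' (- 1)) (abs_sin_coeff k *\<^sub>R y' (2 * k))) has_sum
        \<phi> (x' 1 - x' (- 1)) (abs_sin_series y')) UNIV"
      by (rule has_sum_bounded_linear[OF \<phi>.bounded_linear_right has_sum_abs_sin_series[OF y']])
    moreover have "((\<lambda>k. \<phi> (abs_sin_coeff k *\<^sub>R x' (2 * k)) (y' 1 - y' (- 1))) has_sum
        \<phi> (abs_sin_series x') (y' 1 - y' (- 1))) UNIV"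
      by (rule has_sum_bounded_linear[OF \<phi>.bounded_linear_left has_sum_abs_sin_series[OF x']])
    ultimately have "((\<lambda>k. \<phi> (x' 1 - x' (- 1)) (abs_sin_coeff k *\<^sub>R y' (2 * k)) -
        \<phi> (abs_sin_coeff k *\<^sub>R x' (2 * k)) (y' 1 - y' (- 1))) has_sum 0) UNIV"
      using has_sum_minus zero_product_antisymmetry[of \<phi> x' B y' z', OF \<phi> left right zero x' y' z'] by fastforce
    moreover have "\<phi> (x' 1 - x' (- 1)) (abs_sin_coeff k *\<^sub>R y' (2 * k)) -
        \<phi> (abs_sin_coeff k *\<^sub>R x' (2 * k)) (y' 1 - y' (- 1)) =
        cis ((2 * of_int k + 1) * \<tau>) *\<^sub>C u k - cis ((2 * of_int k - 1) * \<tau>) *\<^sub>C w k" for k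
      unfolding x'_def y'_def u_def w_def \<psi>_def
      by (simp add: \<phi>.diff_left \<phi>.diff_right \<phi>.scaleR_left \<phi>.scaleR_right left right scaleC.diff_right
          scaleC.scaleR_right cis_scaleC_cis scaleR_diff_right algebra_simps)
    ultimately have sum0: "((\<lambda>k. cis ((2 * of_int k + 1) * \<tau>) *\<^sub>C u k - cis ((2 * of_int k - 1) * \<tau>) *\<^sub>C w k)
        has_sum 0) UNIV" by simp
    have angle: "- \<tau> + (2 * of_int k + 1) * \<tau> = t * of_int k"
      "- \<tau> + (2 * of_int k - 1) * \<tau> = t * of_int (k - 1)" for k :: int
      by (simp_all add: \<tau>_def field_simps)
    from has_sum_bounded_linear[OF scaleC.bounded_linear_right sum0, of "cis (- \<tau>)"]
    have total: "((\<lambda>k. cis (t * of_int k) *\<^sub>C u k - cis (t * of_int (k - 1)) *\<^sub>C w k) has_sum 0) UNIV"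
      by (simp only: scaleC.diff_right cis_scaleC_cis scaleC.zero_right angle)
    have "(\<lambda>k. cis (t * of_int k) *\<^sub>C u k) summable_on UNIV"
      by (rule abs_summable_summable) (use su in \<open>simp add: norm_scaleC\<close>)
    then have P: "((\<lambda>k. cis (t * of_int k) *\<^sub>C u k) has_sum infsum (\<lambda>k. cis (t * of_int k) *\<^sub>C u k) UNIV) UNIV"
      by (rule has_sum_infsum)
    from has_sum_minus[OF this total]
    have "((\<lambda>k. cis (t * of_int (k - 1)) *\<^sub>C w k) has_sum infsum (\<lambda>k. cis (t * of_int k) *\<^sub>C u k) UNIV) UNIV"
      by simp
    from has_sum_minus[OF P has_sum_int_shift[OF this, of 1]]
    show ?thesis by (simp add: scaleC.diff_right)
  qed
  then have "u 0 - w (0 + 1) = 0"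
  proof (rule fourier_coefficient_zero[rotated])
    show "(\<lambda>k. norm (u k - w (k + 1))) summable_on UNIV"
      by (rule summable_on_comparison_test[OF summable_on_add[OF su sw1]])
        (auto intro: norm_triangle_ineq4)
  qed
  then have "\<psi> 1 0 = (- 1 / 3) *\<^sub>R \<psi> (- 1) 2" by (simp add: u_def w_def eq_neg_iff_add_eq_0)
  then have "3 *\<^sub>R \<psi> 1 0 = - \<psi> (- 1) 2" by simp
  then show ?thesis unfolding \<psi>_def by simp
qed

lemma bounded_arithmetic_progression:
  fixes E :: "nat \<Rightarrow> 'x::real_normed_vector"
  assumes bounded: "\<And>n. norm (E n) \<le> B" and step: "\<And>n. E (Suc n) = E n + v"
  shows "v = 0"
proof (rule ccontr)
  assume "v \<noteq> 0"
  have E: "E n = E 0 + real n *\<^sub>R v" for n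
    by (induction n) (simp_all add: step scaleR_add_left algebra_simps)
  obtain n where n: "real n * norm v > 2 * B"
    using reals_Archimedean3[of "norm v"] \<open>v \<noteq> 0\<close> by auto
  have "real n * norm v = norm (E n - E 0)" by (simp add: E[of n])
  also have "\<dots> \<le> norm (E n) + norm (E 0)" by (rule norm_triangle_ineq4)
  also have "\<dots> \<le> 2 * B" using bounded[of n] bounded[of 0] by simp
  finally show False using n by simp
qed

lemma bounded_third_difference_zero:
  fixes D :: "nat \<Rightarrow> 'x::real_normed_vector"
  assumes bounded: "\<And>n. norm (D n) \<le> B"
    and diff: "\<And>n. 3 *\<^sub>R (D (n + 2) - D (n + 1)) = D (n + 3) - D n"
  shows "D (Suc n) = D n"
proof -
  define E where "E n = D (Suc n) - D n" for n
  have E: "norm (E n) \<le> 2 * B" for n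
    unfolding E_def using norm_triangle_ineq4[of "D (Suc n)" "D n"] bounded[of n] bounded[of "Suc n"]
    by linarith
  have step: "E (Suc (Suc n)) - E (Suc n) = E (Suc n) - E n" for n
  proof -
    have "3 *\<^sub>R v = v + v + v" for v :: 'x
      using scaleR_add_left[of 1 2 v] by (simp add: scaleR_2 add.assoc)
    then show ?thesis
      using diff[of n] unfolding E_def by (simp add: eval_nat_numeral algebra_simps)
  qed
  have const: "E (Suc n) - E n = E 1 - E 0" for n
    by (induction n) (simp_all add: step)
  have "E 1 - E 0 = 0"
    by (rule bounded_arithmetic_progression[of E, OF E]) (metis const add.commute diff_add_cancel)
  then have "E (Suc n) = E n" for n using const[of n] by simp
  then have "E n = E 0" for n by (induction n) simp_all
  then have "D (Suc n) = D n + E 0" for n by (metis E_def add.commute diff_add_cancel)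
  then have "E 0 = 0" by (rule bounded_arithmetic_progression[of D, OF bounded])
  then show ?thesis using \<open>D (Suc n) = D n + E 0\<close> by simp
qed

text \<open>
  The antidiagonal sequence \<open>n \<mapsto> \<phi>(x n, y (1 - n))\<close> is bounded and has zero third difference, because
  the families may be translated in opposite directions; hence it is constant.
\<close>

lemma zero_product_shift:
  fixes x y z :: "int \<Rightarrow> 'a::{complex_normed_algebra, complex_banach}"
    and \<phi> :: "'a \<Rightarrow> 'a \<Rightarrow> 'x::complex_banach"
  assumes \<phi>: "bounded_bilinear \<phi>"
    and left: "\<And>c a b. \<phi> (c *\<^sub>C a) b = c *\<^sub>C \<phi> a b"
    and right: "\<And>c a b. \<phi> a (c *\<^sub>C b) = c *\<^sub>C \<phi> a b"
    and zero: "\<And>a b. a * b = 0 \<Longrightarrow> \<phi> a b = 0"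
    and x: "\<And>j. norm (x j) \<le> B" and y: "\<And>j. norm (y j) \<le> B"
    and z: "\<And>j k. x j * y k = z (j + k)"
  shows "\<phi> (x 1) (y 0) = \<phi> (x 0) (y 1)"
proof -
  interpret \<phi>: bounded_bilinear \<phi> by (rule \<phi>)
  obtain C where C: "C \<ge> 0" "\<And>a b. norm (\<phi> a b) \<le> norm a * norm b * C"
    using \<phi>.nonneg_bounded by blast
  have B: "B \<ge> 0" using x[of 0] norm_ge_zero order_trans by blast
  define D where "D n = \<phi> (x (int n)) (y (1 - int n))" for n
  have "D (Suc 0) = D 0"
  proof (rule bounded_third_difference_zero)
    fix n
    show "norm (D n) \<le> B * B * C"
      using C(2)[of "x (int n)" "y (1 - int n)"]
        mult_right_mono[OF mult_mono[OF x[of "int n"] y[of "1 - int n"] B norm_ge_zero] C(1)]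
      unfolding D_def by linarith
    show "3 *\<^sub>R (D (n + 2) - D (n + 1)) = D (n + 3) - D n"
      using zero_product_third_difference[OF \<phi> left right zero x y,
          of "\<lambda>j. j + (int n + 1)" "\<lambda>j. j - (int n + 1)" z]
      by (simp add: z D_def algebra_simps)
  qed
  then show ?thesis by (simp add: D_def)
qed

section \<open>Quasi-unitary elements\<close>

lemma star_minus: "star (- x) = - star (x :: 'a::cstar_algebra)"
  using star_add[of x "- x"] star_add[of "0 :: 'a" 0] by (simp add: eq_neg_iff_add_eq_0 add.commute)

lemma star_diff: "star (x - y) = star x - star (y :: 'a::cstar_algebra)"
  using star_add[of x "- y"] by (simp add: star_minus)

lemma norm_star: "norm (star x) = norm (x :: 'a::cstar_algebra)"
proof -
  have le: "norm y \<le> norm (star y)" for y :: 'a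
  proof (cases "norm y = 0")
    case False
    have "norm y * norm y \<le> norm (star y) * norm y"
      using norm_mult_ineq[of "star y" y] by (simp add: cstar_identity power2_eq_square)
    then show ?thesis using False by simp
  qed simp
  show ?thesis using le[of x] le[of "star x"] by (simp add: star_star)
qed

lemma norm_mult_star: "norm (x * star x) = (norm (x :: 'a::cstar_algebra))\<^sup>2"
  using cstar_identity[of "star x"] by (simp add: star_star norm_star)

text \<open>
  The element \<open>1 + p\<close> of the unitization is unitary. Working with \<open>p\<close> avoids adjoining a unit.
\<close>

definition quasi_unitary :: "'a::cstar_algebra \<Rightarrow> bool"
  where "quasi_unitary p \<longleftrightarrow> p + star p + star p * p = 0 \<and> p + star p + p * star p = 0"

lemma quasi_unitary_star: "quasi_unitary p \<Longrightarrow> quasi_unitary (star p)"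
  by (simp add: quasi_unitary_def star_star add.commute)

lemma norm_quasi_unitary_left:
  assumes "quasi_unitary p"
  shows "norm (b + p * b) = norm b"
proof -
  have "star (b + p * b) * (b + p * b) = star b * b + star b * (p + star p + star p * p) * b"
    by (simp add: star_add star_mult algebra_simps)
  also have "\<dots> = star b * b" using assms by (simp add: quasi_unitary_def)
  finally have "(norm (b + p * b))\<^sup>2 = (norm b)\<^sup>2" by (metis cstar_identity)
  then show ?thesis by simp
qed

lemma norm_quasi_unitary_right:
  assumes "quasi_unitary p"
  shows "norm (b + b * p) = norm b"
  using norm_quasi_unitary_left[OF quasi_unitary_star[OF assms], of "star b"] norm_star[of "b + b * p"]
  by (simp add: star_add star_mult norm_star)

text \<open>
  Multiplication of \<open>1 + a\<close> and \<open>1 + b\<close> in the unitization.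
\<close>

definition circle :: "'a::ring \<Rightarrow> 'a \<Rightarrow> 'a"
  where "circle a b = a + b + a * b"

lemma circle_assoc: "circle (circle a b) c = circle a (circle b c)"
  by (simp add: circle_def algebra_simps)

lemma circle_zero [simp]: "circle 0 a = a" "circle a 0 = a"
  by (simp_all add: circle_def)

text \<open>
  The element \<open>(1 + p)\<^sup>j - 1\<close>, the inverse of \<open>1 + p\<close> being its adjoint.
\<close>

definition circle_power :: "'a::cstar_algebra \<Rightarrow> int \<Rightarrow> 'a"
  where "circle_power p j =
    (if j \<ge> 0 then (circle p ^^ nat j) 0 else (circle (star p) ^^ nat (- j)) 0)"

lemma circle_power_values [simp]: "circle_power p 0 = 0" "circle_power p 1 = p"
  by (simp_all add: circle_power_def)

lemma circle_power_step:
  assumes "quasi_unitary p"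
  shows "circle_power p (j + 1) = circle p (circle_power p j)"
    and "circle_power p (j - 1) = circle (star p) (circle_power p j)"
proof -
  have "circle p (star p) = 0" "circle (star p) p = 0"
    using assms by (simp_all add: circle_def quasi_unitary_def add.commute)
  then have inv: "circle p (circle (star p) a) = a" "circle (star p) (circle p a) = a" for a
    by (simp_all only: circle_assoc[symmetric] circle_zero)
  have nat1: "circle_power p (int n) = (circle p ^^ n) 0" for n
    by (simp add: circle_power_def)
  have nat2: "circle_power p (- int n) = (circle (star p) ^^ n) 0" for n
    by (cases "n = 0") (simp_all add: circle_power_def)
  have pos: "circle_power p (int n + 1) = circle p (circle_power p (int n))" for n
  proof -
    have "int n + 1 = int (Suc n)" by simp
    then show ?thesis by (simp only: nat1 funpow.simps o_apply)
  qed
  have neg: "circle_power p (- int n - 1) = circle (star p) (circle_power p (- int n))" for n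
  proof -
    have "- int n - 1 = - int (Suc n)" by simp
    then show ?thesis by (simp only: nat2 funpow.simps o_apply)
  qed
  have up: "circle_power p (j + 1) = circle p (circle_power p j)" for j
  proof (cases "j \<ge> 0")
    case True
    then show ?thesis using pos[of "nat j"] by simp
  next
    case False
    then have "circle_power p j = circle (star p) (circle_power p (j + 1))"
      using neg[of "nat (- j - 1)"] by (simp add: add.commute)
    then show ?thesis by (simp only: inv)
  qed
  show "circle_power p (j + 1) = circle p (circle_power p j)" by (rule up)
  show "circle_power p (j - 1) = circle (star p) (circle_power p j)"
    using up[of "j - 1"] by (simp only: inv diff_add_cancel)
qed

lemma circle_power_add:
  assumes p: "quasi_unitary p"
  shows "circle_power p (j + k) = circle (circle_power p j) (circle_power p k)"
proof (induction j rule: int_induct[where k = 0])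
  case (step1 i)
  then show ?case
    using circle_power_step(1)[OF p, of i] circle_power_step(1)[OF p, of "i + k"]
    by (simp add: circle_assoc algebra_simps)
next
  case (step2 i)
  then show ?case
    using circle_power_step(2)[OF p, of i] circle_power_step(2)[OF p, of "i + k"]
    by (simp add: circle_assoc algebra_simps)
qed simp

lemma mult_circle:
  "(a + a * circle p q) = (a + a * p) + (a + a * p) * q" "c + circle p q * c = (c + q * c) + p * (c + q * c)"
  by (simp_all add: circle_def algebra_simps)

lemma norm_circle_power_left:
  assumes p: "quasi_unitary p"
  shows "norm (b + circle_power p j * b) = norm b"
proof (induction j rule: int_induct[where k = 0])
  case (step1 i)
  then show ?case
    by (simp only: circle_power_step[OF p] mult_circle norm_quasi_unitary_left[OF p])
next
  case (step2 i)
  then show ?case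
    by (simp only: circle_power_step[OF p] mult_circle norm_quasi_unitary_left[OF quasi_unitary_star[OF p]])
qed simp

lemma norm_circle_power_right:
  assumes p: "quasi_unitary p"
  shows "norm (b + b * circle_power p j) = norm b"
proof (induction j rule: int_induct[where k = 0])
  case (step1 i)
  have "circle_power p (i + 1) = circle (circle_power p i) p"
    using circle_power_add[OF p, of i 1] by simp
  then show ?case using step1 by (simp only: mult_circle norm_quasi_unitary_right[OF p])
next
  case (step2 i)
  have "circle_power p (i - 1) = circle (circle_power p i) (star p)"
    using circle_power_add[OF p, of i "- 1"] circle_power_step(2)[OF p, of 0] by simp
  then show ?case
    using step2 by (simp only: mult_circle norm_quasi_unitary_right[OF quasi_unitary_star[OF p]])
qed simp

lemma mult_circle_power:
  assumes p: "quasi_unitary p"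
  shows "(a + a * circle_power p j) * (c + circle_power p k * c) =
    a * (c + circle_power p (j + k) * c)"
  by (simp add: circle_power_add[OF p] circle_def algebra_simps)

text \<open>
  The Cayley transform: \<open>k = h(1 - ih)\<^sup>-\<^sup>1\<close> exists as a fixed point of the contraction \<open>k \<mapsto> h + ihk\<close>, and
  \<open>(1 + ih)(1 - ih)\<^sup>-\<^sup>1 = 1 + 2ik\<close>.
\<close>

lemma quasi_unitary_exists:
  fixes h :: "'a::cstar_algebra"
  assumes h: "star h = h" "norm h < 1"
  obtains k where "k = h + \<i> *\<^sub>C (h * k)" "k = h + \<i> *\<^sub>C (k * h)" "quasi_unitary ((2 * \<i>) *\<^sub>C k)"
proof -
  have solve: "\<exists>!k. b + \<i> *\<^sub>C (h * k) = k" for b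
  proof (rule banach_fix_type[OF _ h(2)])
    have "dist (b + \<i> *\<^sub>C (h * x)) (b + \<i> *\<^sub>C (h * y)) \<le> norm h * dist x y" for x y
    proof -
      have "dist (b + \<i> *\<^sub>C (h * x)) (b + \<i> *\<^sub>C (h * y)) = norm (\<i> *\<^sub>C (h * (x - y)))"
        by (simp add: dist_norm right_diff_distrib scaleC.diff_right)
      also have "\<dots> \<le> norm h * norm (x - y)" by (simp add: norm_scaleC norm_mult_ineq)
      finally show ?thesis by (simp add: dist_norm)
    qed
    then show "\<forall>x y. dist (b + \<i> *\<^sub>C (h * x)) (b + \<i> *\<^sub>C (h * y)) \<le> norm h * dist x y" by blast
  qed simp
  from solve[of h] obtain k where k: "k = h + \<i> *\<^sub>C (h * k)" by metis
  have "h * h + \<i> *\<^sub>C (h * (h * k)) = h * (h + \<i> *\<^sub>C (h * k))"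
    by (simp add: distrib_left mult_scaleC_right)
  also have "\<dots> = h * k" unfolding k[symmetric] ..
  finally have "h * h + \<i> *\<^sub>C (h * (h * k)) = h * k" .
  moreover have "h * h + \<i> *\<^sub>C (h * (k * h)) = (h + \<i> *\<^sub>C (h * k)) * h"
    by (simp add: distrib_right mult_scaleC_left mult.assoc)
  then have "h * h + \<i> *\<^sub>C (h * (k * h)) = k * h" unfolding k[symmetric] .
  ultimately have comm: "h * k = k * h" using solve[of "h * h"] by metis
  have k': "k = h + \<i> *\<^sub>C (k * h)" using k unfolding comm .
  have hk: "h * k = \<i> *\<^sub>C (h - k)"
  proof -
    have "k - h = \<i> *\<^sub>C (h * k)" using k by (simp only: diff_eq_eq add.commute)
    then have "h - k = - (\<i> *\<^sub>C (h * k))" by (metis minus_diff_eq)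
    then show ?thesis by (simp add: scaleC.minus_right scaleC_scaleC scaleC.minus_left scaleC_one)
  qed
  have kh: "k * h = \<i> *\<^sub>C (h - k)" using hk comm by simp
  have sh: "star k * h = - (\<i> *\<^sub>C (h - star k))" "h * star k = - (\<i> *\<^sub>C (h - star k))"
    using arg_cong[OF hk, of star] arg_cong[OF kh, of star]
    by (simp_all add: star_mult h(1) star_scaleC star_diff scaleC.minus_left)
  \<comment> \<open>Evaluating \<open>k*hk\<close> in two ways expresses \<open>k*k\<close> through \<open>k\<close> and its adjoint.\<close>
  have 1: "star k * k + star k * k = \<i> *\<^sub>C (star k - k)"
  proof -
    have "star k * (h * k) = \<i> *\<^sub>C (star k * h - star k * k)"
      by (simp only: hk mult_scaleC_right right_diff_distrib)
    moreover have "star k * h * k = \<i> *\<^sub>C (- (h * k - star k * k))"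
      by (simp only: sh(1) mult_scaleC_left left_diff_distrib mult_minus_left scaleC.minus_right)
    ultimately have "\<i> *\<^sub>C (star k * h - star k * k) = \<i> *\<^sub>C (- (h * k - star k * k))"
      by (simp only: mult.assoc)
    then have "star k * h - star k * k = - (h * k - star k * k)" by (rule scaleC_cancel_left) simp
    then have "star k * k + star k * k = star k * h + h * k" by (simp add: algebra_simps)
    then show ?thesis unfolding hk sh by (simp add: scaleC.diff_right)
  qed
  have 2: "k * star k + k * star k = \<i> *\<^sub>C (star k - k)"
  proof -
    have "k * (h * star k) = \<i> *\<^sub>C (- (k * h - k * star k))"
      by (simp only: sh(2) mult_scaleC_right right_diff_distrib mult_minus_right scaleC.minus_right)
    moreover have "k * h * star k = \<i> *\<^sub>C (h * star k - k * star k)"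
      by (simp only: kh mult_scaleC_left left_diff_distrib)
    ultimately have "\<i> *\<^sub>C (- (k * h - k * star k)) = \<i> *\<^sub>C (h * star k - k * star k)"
      by (simp only: mult.assoc)
    then have "- (k * h - k * star k) = h * star k - k * star k" by (rule scaleC_cancel_left) simp
    then have "k * star k + k * star k = k * h + h * star k" by (simp add: algebra_simps)
    then show ?thesis unfolding kh sh by (simp add: scaleC.diff_right)
  qed
  have "quasi_unitary ((2 * \<i>) *\<^sub>C k)"
  proof -
    have four: "4 *\<^sub>C v = 2 *\<^sub>C (v + v)" for v :: 'a
      by (simp add: scaleC_add_right scaleC_add_left[symmetric])
    have star: "star ((2 * \<i>) *\<^sub>C k) = - ((2 * \<i>) *\<^sub>C star k)"
      by (simp add: star_scaleC scaleC.minus_left)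
    have A: "- ((2 * \<i>) *\<^sub>C star k) * (2 * \<i>) *\<^sub>C k = 2 *\<^sub>C (star k * k + star k * k)"
      "(2 * \<i>) *\<^sub>C k * - ((2 * \<i>) *\<^sub>C star k) = 2 *\<^sub>C (k * star k + k * star k)"
      by (simp_all add: mult_scaleC_left mult_scaleC_right scaleC_scaleC scaleC.minus_left scaleC.minus_right four)
    show ?thesis
      unfolding quasi_unitary_def star A 1 2
      by (simp add: scaleC_scaleC scaleC.diff_right)
  qed
  with k k' show thesis by (rule that)
qed

text \<open>
  With \<open>u = 1 + p\<close> the Cayley transform of \<open>h\<close>, the families \<open>a'u\<^sup>j\<close> and \<open>u\<^sup>jc'\<close> are bounded, so that
  \<open>\<phi>(a'u,c') = \<phi>(a',uc')\<close>. The substitutions \<open>a' = a(1 - ih)\<close> and \<open>c' = (1 - ih)c\<close> turn this into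
  \<open>\<phi>(a(1 + ih), (1 - ih)c) = \<phi>(a(1 - ih), (1 + ih)c)\<close>, which says \<open>\<phi>(ah,c) = \<phi>(a,hc)\<close>.
\<close>

lemma zero_product_balanced_selfadjoint:
  fixes \<phi> :: "'a::cstar_algebra \<Rightarrow> 'a \<Rightarrow> 'x::complex_banach"
  assumes \<phi>: "bounded_bilinear \<phi>"
    and left: "\<And>c a b. \<phi> (c *\<^sub>C a) b = c *\<^sub>C \<phi> a b"
    and right: "\<And>c a b. \<phi> a (c *\<^sub>C b) = c *\<^sub>C \<phi> a b"
    and zero: "\<And>a b. a * b = 0 \<Longrightarrow> \<phi> a b = 0"
    and h: "star h = h" "norm h < 1"
  shows "\<phi> (a * h) c = \<phi> a (h * c)"
proof -
  interpret \<phi>: bounded_bilinear \<phi> by (rule \<phi>)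
  obtain k where k: "k = h + \<i> *\<^sub>C (h * k)" "k = h + \<i> *\<^sub>C (k * h)" "quasi_unitary ((2 * \<i>) *\<^sub>C k)"
    by (rule quasi_unitary_exists[OF h])
  define p where "p = (2 * \<i>) *\<^sub>C k"
  have p: "quasi_unitary p" using k(3) by (simp add: p_def)
  define a' where "a' = a - \<i> *\<^sub>C (a * h)"
  define c' where "c' = c - \<i> *\<^sub>C (h * c)"
  define x where "x j = a' + a' * circle_power p j" for j
  define y where "y j = c' + circle_power p j * c'" for j
  have "\<phi> (x 1) (y 0) = \<phi> (x 0) (y 1)"
  proof (rule zero_product_shift[OF \<phi> left right zero])
    show "norm (x j) \<le> max (norm a') (norm c')" "norm (y j) \<le> max (norm a') (norm c')" for j
      by (simp_all add: x_def y_def norm_circle_power_left[OF p] norm_circle_power_right[OF p])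
    show "x j * y k = a' * (c' + circle_power p (j + k) * c')" for j k
      unfolding x_def y_def by (rule mult_circle_power[OF p])
  qed
  then have eq: "\<phi> (a' + a' * p) c' = \<phi> a' (c' + p * c')" by (simp add: x_def y_def)
  have hk: "h = k - \<i> *\<^sub>C (h * k)" "h = k - \<i> *\<^sub>C (k * h)" 
    using k(1,2) by (simp_all only: eq_diff_eq)
  have two: "(2 * \<i>) *\<^sub>C v = \<i> *\<^sub>C v + \<i> *\<^sub>C v" for v :: 'a
    by (simp only: mult_2 scaleC_add_left)
  have "a' * k = a * (k - \<i> *\<^sub>C (h * k))"
    by (simp add: a'_def left_diff_distrib right_diff_distrib mult_scaleC_left mult_scaleC_right mult.assoc)
  then have "a' * k = a * h" by (simp only: hk(1)[symmetric])
  moreover have "a' * p = (2 * \<i>) *\<^sub>C (a' * k)" by (simp only: p_def mult_scaleC_right)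
  ultimately have "a' * p = \<i> *\<^sub>C (a * h) + \<i> *\<^sub>C (a * h)" by (simp only: two)
  then have ap: "a' + a' * p = a + \<i> *\<^sub>C (a * h)" by (simp add: a'_def)
  have "k * c' = (k - \<i> *\<^sub>C (k * h)) * c"
    by (simp add: c'_def left_diff_distrib right_diff_distrib mult_scaleC_left mult_scaleC_right mult.assoc)
  then have "k * c' = h * c" by (simp only: hk(2)[symmetric])
  moreover have "p * c' = (2 * \<i>) *\<^sub>C (k * c')" by (simp only: p_def mult_scaleC_left)
  ultimately have "p * c' = \<i> *\<^sub>C (h * c) + \<i> *\<^sub>C (h * c)" by (simp only: two)
  then have cp: "c' + p * c' = c + \<i> *\<^sub>C (h * c)" by (simp add: c'_def)
  have "\<phi> (a + \<i> *\<^sub>C (a * h)) (c - \<i> *\<^sub>C (h * c)) = \<phi> (a - \<i> *\<^sub>C (a * h)) (c + \<i> *\<^sub>C (h * c))"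
    using eq unfolding ap cp by (simp add: a'_def c'_def)
  then have "\<i> *\<^sub>C \<phi> (a * h) c + \<i> *\<^sub>C \<phi> (a * h) c = \<i> *\<^sub>C \<phi> a (h * c) + \<i> *\<^sub>C \<phi> a (h * c)"
    by (simp add: \<phi>.add_left \<phi>.add_right \<phi>.diff_left \<phi>.diff_right left right algebra_simps
        scaleC.diff_right scaleC_add_right)
  then have "2 *\<^sub>R \<i> *\<^sub>C \<phi> (a * h) c = 2 *\<^sub>R \<i> *\<^sub>C \<phi> a (h * c)" by (simp only: scaleR_2)
  then have "\<i> *\<^sub>C \<phi> (a * h) c = \<i> *\<^sub>C \<phi> a (h * c)" by simp
  then show ?thesis by (rule scaleC_cancel_left) simp
qed

lemma zero_product_balanced:
  fixes \<phi> :: "'a::cstar_algebra \<Rightarrow> 'a \<Rightarrow> 'x::complex_banach"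
  assumes \<phi>: "bounded_bilinear \<phi>"
    and left: "\<And>c a b. \<phi> (c *\<^sub>C a) b = c *\<^sub>C \<phi> a b"
    and right: "\<And>c a b. \<phi> a (c *\<^sub>C b) = c *\<^sub>C \<phi> a b"
    and zero: "\<And>a b. a * b = 0 \<Longrightarrow> \<phi> a b = 0"
  shows "\<phi> (a * b) c = \<phi> a (b * c)"
proof -
  interpret \<phi>: bounded_bilinear \<phi> by (rule \<phi>)
  have sa: "\<phi> (a * h) c = \<phi> a (h * c)" if "star h = h" for h
  proof -
    define t where "t = inverse (norm h + 1)"
    have t: "t > 0" by (simp add: t_def add_nonneg_pos)
    have "star (t *\<^sub>R h) = t *\<^sub>R h" using that by (simp add: scaleR_scaleC star_scaleC)
    moreover have "norm (t *\<^sub>R h) < 1"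
      using add_nonneg_pos[of "norm h" 1] by (simp add: t_def field_simps)
    ultimately have "\<phi> (a * t *\<^sub>R h) c = \<phi> a (t *\<^sub>R h * c)"
      using zero_product_balanced_selfadjoint[of \<phi> "t *\<^sub>R h" a c, OF assms] by blast
    then show ?thesis using t by (simp add: \<phi>.scaleR_left \<phi>.scaleR_right)
  qed
  define u where "u = b + star b"
  define v where "v = \<i> *\<^sub>C (b - star b)"
  have u: "star u = u" by (simp add: u_def star_add star_star add.commute)
  have v: "star v = v" by (simp add: v_def star_diff star_scaleC star_star scaleC.minus_left scaleC.diff_right)
  have b: "2 *\<^sub>R b = u - \<i> *\<^sub>C v"
    by (simp add: u_def v_def scaleC_scaleC scaleC.minus_left scaleC_one scaleR_2)
  have "\<phi> (a * (2 *\<^sub>R b)) c = \<phi> a ((2 *\<^sub>R b) * c)"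
    unfolding b by (simp add: left_diff_distrib right_diff_distrib mult_scaleC_left mult_scaleC_right
        \<phi>.diff_left \<phi>.diff_right left right sa[OF u] sa[OF v])
  then show ?thesis by (simp add: \<phi>.scaleR_left \<phi>.scaleR_right)
qed

section \<open>Approximate units\<close>

definition right_ideal :: "'a::complex_normed_algebra set \<Rightarrow> bool"
  where "right_ideal J \<longleftrightarrow>
    (\<forall>a\<in>J. \<forall>b\<in>J. a + b \<in> J) \<and> (\<forall>c. \<forall>a\<in>J. c *\<^sub>C a \<in> J) \<and> (\<forall>a\<in>J. \<forall>b. a * b \<in> J)"

lemma right_ideal_sum:
  assumes J: "right_ideal J" "h \<in> J" and f: "\<And>i. i \<in> I \<Longrightarrow> f i \<in> J"
  shows "sum f I \<in> J"
proof (cases "finite I")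
  case True
  have "0 \<in> J" using J unfolding right_ideal_def by (metis mult_zero_right)
  show ?thesis
    using True f
  proof (induction I rule: finite_induct)
    case (insert i I)
    then show ?case using J unfolding right_ideal_def by simp
  qed (use \<open>0 \<in> J\<close> in simp)
next
  case False
  have "0 \<in> J" using J unfolding right_ideal_def by (metis mult_zero_right)
  then show ?thesis using False by simp
qed

text \<open>
  The element \<open>1 - e\<close> is the mean of the first \<open>N\<close> powers of the Cayley transform \<open>u\<close> of a small
  multiple \<open>h\<close> of \<open>xx*\<close>. It is a contraction, and it nearly annihilates the range of \<open>u - 1\<close>, which is the
  range of \<open>h\<close>; the C*-identity passes from \<open>h\<close> to \<open>x\<close>. The last property, that \<open>e\<close> lies in every right
  ideal containing \<open>xx*\<close>, is used for closed right ideals.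
\<close>

lemma approximate_left_unit:
  fixes x :: "'a::cstar_algebra"
  assumes "\<epsilon> > 0"
  obtains e where "\<And>b. norm (b - e * b) \<le> norm b" "norm (x - e * x) < \<epsilon>"
    "\<And>J. right_ideal J \<Longrightarrow> x * star x \<in> J \<Longrightarrow> e \<in> J"
proof -
  define t where "t = inverse (norm (x * star x) + 1)"
  have t: "t > 0" by (simp add: t_def add_nonneg_pos)
  define h where "h = t *\<^sub>R (x * star x)"
  have h: "star h = h" "norm h < 1"
  proof -
    show "star h = h" by (simp add: h_def scaleR_scaleC star_scaleC star_mult star_star)
    show "norm h < 1"
      using add_nonneg_pos[of "norm (x * star x)" 1] by (simp add: h_def t_def field_simps)
  qed
  obtain k where k: "k = h + \<i> *\<^sub>C (h * k)" "k = h + \<i> *\<^sub>C (k * h)" "quasi_unitary ((2 * \<i>) *\<^sub>C k)"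
    by (rule quasi_unitary_exists[OF h])
  define p where "p = (2 * \<i>) *\<^sub>C k"
  have p: "quasi_unitary p" using k(3) by (simp add: p_def)
  define P where "P n = circle_power p (int n)" for n
  obtain N :: nat where N: "2 / (t * \<epsilon>\<^sup>2) < real N" using reals_Archimedean2 by blast
  have N0: "real N > 0"
    by (rule le_less_trans[OF _ N]) (use t assms in simp)
  define M where "M b = (1 / real N) *\<^sub>R (\<Sum>n<N. b + P n * b)" for b
  define e where "e = - ((1 / real N) *\<^sub>R (\<Sum>n<N. P n))"
  have M: "b - e * b = M b" for b
  proof -
    have "M b = (1 / real N) *\<^sub>R (real N *\<^sub>R b) + (1 / real N) *\<^sub>R ((\<Sum>n<N. P n) * b)"
      unfolding M_def by (simp add: sum.distrib scaleR_add_right sum_distrib_right sum_constant_scaleR)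
    then show ?thesis using N0 by (simp add: e_def)
  qed
  have norm_M: "norm (M b) \<le> norm b" for b
  proof -
    have "norm (\<Sum>n<N. b + P n * b) \<le> real N * norm b"
      using sum_norm_le[of "{..<N}" "\<lambda>n. b + P n * b" "\<lambda>_. norm b"]
      by (simp add: P_def norm_circle_power_left[OF p])
    then show ?thesis using N0 by (simp add: M_def field_simps)
  qed
  have M_mult: "M b * c = M (b * c)" for b c
    by (simp add: M_def sum_distrib_right distrib_right mult.assoc)
  have M_p: "M (p * b) = (1 / real N) *\<^sub>R (P N * b)" for b
  proof -
    have "P (Suc n) = P n + p + P n * p" for n
      using circle_power_add[OF p, of "int n" 1] by (simp add: P_def circle_def add.commute)
    then have "p * b + P n * (p * b) = P (Suc n) * b - P n * b" for n
      by (simp add: distrib_right mult.assoc)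
    then have "M (p * b) = (1 / real N) *\<^sub>R (\<Sum>n<N. P (Suc n) * b - P n * b)"
      unfolding M_def by (simp only:)
    also have "(\<Sum>n<N. P (Suc n) * b - P n * b) = P N * b - P 0 * b"
      by (rule sum_lessThan_telescope)
    finally show ?thesis by (simp add: P_def)
  qed
  \<comment> \<open>The element \<open>hy\<close> is \<open>(u - 1)v / (2i)\<close> with \<open>v = (1 - ih)y\<close>, so its mean is of order \<open>1 / N\<close>.\<close>
  have M_h: "norm (M (h * y)) \<le> 2 * norm y / real N" for y
  proof -
    define v where "v = y - \<i> *\<^sub>C (h * y)"
    have "k - \<i> *\<^sub>C (k * h) = h" using k(2) by (simp only: diff_eq_eq)
    moreover have "k * v = (k - \<i> *\<^sub>C (k * h)) * y"
      by (simp add: v_def left_diff_distrib right_diff_distrib mult_scaleC_left mult_scaleC_right mult.assoc)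
    ultimately have "k * v = h * y" by (simp only:)
    then have "p * v = (2 * \<i>) *\<^sub>C (h * y)" by (simp only: p_def mult_scaleC_left)
    moreover have "M ((2 * \<i>) *\<^sub>C b) = (2 * \<i>) *\<^sub>C M b" for b
      unfolding M_def
      by (simp add: mult_scaleC_right scaleC.sum_right scaleC_add_right scaleC.scaleR_right)
    ultimately have "(2 * \<i>) *\<^sub>C M (h * y) = (1 / real N) *\<^sub>R (P N * v)"
      using M_p[of v] by simp
    then have "norm ((2 * \<i>) *\<^sub>C M (h * y)) = norm (P N * v) / real N" using N0 by simp
    then have "2 * norm (M (h * y)) = norm (P N * v) / real N" by (simp add: norm_scaleC norm_mult)
    also have "norm (P N * v) \<le> 2 * norm v"
      using norm_triangle_ineq4[of "v + P N * v" v] by (simp add: P_def norm_circle_power_left[OF p])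
    also have "norm v \<le> 2 * norm y"
    proof -
      have "norm (h * y) \<le> norm h * norm y" by (rule norm_mult_ineq)
      also have "\<dots> \<le> 1 * norm y" using h(2) by (intro mult_right_mono) auto
      finally show ?thesis
        using norm_triangle_ineq4[of y "\<i> *\<^sub>C (h * y)"] by (simp add: v_def norm_scaleC)
    qed
    finally show ?thesis using N0 by (simp add: divide_right_mono field_simps)
  qed
  have square_le: "r \<le> c" if "r\<^sup>2 \<le> c * r" "c \<ge> 0" "r \<ge> 0" for r c :: real
    using that by (cases "r = 0") (simp_all add: power2_eq_square)
  have "(norm (M h))\<^sup>2 = norm (M (h * star (M h)))"
    by (simp add: norm_mult_star[symmetric] M_mult)
  also have "\<dots> \<le> 2 / real N * norm (M h)" using M_h[of "star (M h)"] by (simp add: norm_star)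
  finally have Mh: "norm (M h) \<le> 2 / real N" by (rule square_le) (use N0 in simp_all)
  have "(norm (M x))\<^sup>2 = norm (M (x * star (M x)))"
    by (simp add: norm_mult_star[symmetric] M_mult)
  also have "\<dots> \<le> norm (x * star (M x))" by (rule norm_M)
  also have "\<dots> = norm (star (x * star (M x)))" by (simp only: norm_star)
  also have "star (x * star (M x)) = M (x * star x)" by (simp add: star_mult star_star M_mult)
  also have "t * norm (M (x * star x)) = norm (M h)"
  proof -
    have "M h = t *\<^sub>R M (x * star x)"
      by (simp add: M_def h_def scaleR_sum_right scaleR_add_right mult.commute)
    then show ?thesis using t by simp
  qed
  then have "norm (M (x * star x)) = norm (M h) / t" using t by (simp add: field_simps)
  also have "\<dots> \<le> 2 / real N / t" using Mh t by (intro divide_right_mono) simp_all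
  also have "\<dots> < \<epsilon>\<^sup>2" using N N0 t assms by (simp add: field_simps)
  finally have small: "norm (M x) < \<epsilon>" by (rule power_less_imp_less_base) (use assms in simp)
  have "e \<in> J" if J: "right_ideal J" "x * star x \<in> J" for J
  proof -
    have add: "a + b \<in> J" if "a \<in> J" "b \<in> J" for a b
      using J(1) that unfolding right_ideal_def by blast
    have scale: "c *\<^sub>C a \<in> J" and mult: "a * d \<in> J" if "a \<in> J" for a c d
      using J(1) that unfolding right_ideal_def by blast+
    have hJ: "h \<in> J" unfolding h_def scaleR_scaleC by (rule scale[OF J(2)])
    have "h + \<i> *\<^sub>C (h * k) \<in> J" by (intro add scale mult hJ)
    then have "k \<in> J" by (simp only: k(1)[symmetric])
    then have pJ: "p \<in> J" unfolding p_def by (intro scale)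
    have "P n \<in> J" for n
    proof (induction n)
      case 0
      show ?case using mult[OF hJ, of 0] by (simp add: P_def)
    next
      case (Suc n)
      have "P (Suc n) = p + P n + p * P n"
        using circle_power_step(1)[OF p, of "int n"] by (simp add: P_def circle_def add.commute)
      then show ?case using Suc pJ by (simp only:) (intro add mult)
    qed
    then have "(\<Sum>n<N. P n) \<in> J" by (intro right_ideal_sum[OF J(1) hJ])
    then have "complex_of_real (- (1 / real N)) *\<^sub>C (\<Sum>n<N. P n) \<in> J" by (intro scale)
    then show ?thesis by (simp only: e_def scaleR_scaleC[symmetric] scaleR_minus_left)
  qed
  then show thesis using that[of e] norm_M small by (simp add: M)
qed

text \<open>
  With \<open>e\<close> from the preceding lemma, \<open>ex\<close> belongs to the ideal and approximates \<open>x\<close>.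
\<close>

lemma closed_right_ideal_square_root:
  fixes x :: "'a::cstar_algebra"
  assumes J: "right_ideal J" "closed J" and x: "x * star x \<in> J"
  shows "x \<in> J"
proof -
  have "\<exists>y\<in>J. dist y x < \<epsilon>" if pos: "\<epsilon> > 0" for \<epsilon>
  proof -
    obtain e where e: "norm (x - e * x) < \<epsilon>" "e \<in> J"
      using approximate_left_unit[OF pos, of x] J(1) x by metis
    then show ?thesis
      using J(1) unfolding right_ideal_def by (intro bexI[of _ "e * x"]) (simp_all add: dist_norm norm_minus_commute)
  qed
  then show ?thesis using closed_approachable[OF J(2)] by blast
qed

text \<open>
  For each further element \<open>x\<close> the contraction \<open>1 - e\<close> is replaced by \<open>(1 - f)(1 - e)\<close>, where \<open>1 - f\<close> is
  small on \<open>(1 - e)x\<close>; being a contraction, \<open>1 - f\<close> preserves what has been achieved.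
\<close>

lemma finite_left_unit:
  fixes F :: "'a::cstar_algebra set"
  assumes "finite F" "\<epsilon> > 0"
  shows "\<exists>e. (\<forall>b. norm (b - e * b) \<le> norm b) \<and> (\<forall>x\<in>F. norm (x - e * x) < \<epsilon>)"
  using assms(1)
proof (induction F rule: finite_induct)
  case empty
  show ?case by (rule exI[of _ 0]) simp
next
  case (insert x F)
  then obtain e where e: "\<And>b. norm (b - e * b) \<le> norm b" "\<And>x. x \<in> F \<Longrightarrow> norm (x - e * x) < \<epsilon>"
    by blast
  obtain f where f: "\<And>b. norm (b - f * b) \<le> norm b" "norm ((x - e * x) - f * (x - e * x)) < \<epsilon>"
    using approximate_left_unit[OF assms(2), of "x - e * x"] by metis
  define g where "g = e + f - f * e"
  have g: "b - g * b = (b - e * b) - f * (b - e * b)" for b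
    by (simp add: g_def algebra_simps)
  have "norm (b - g * b) \<le> norm b" for b unfolding g using f(1) e(1) order_trans by blast
  moreover have "norm (y - g * y) < \<epsilon>" if "y \<in> insert x F" for y
    unfolding g using that f(2) e(2) le_less_trans[OF f(1)] by blast
  ultimately show ?case by blast
qed

lemma norm_le_two_of_left_unit:
  fixes e :: "'a::cstar_algebra"
  assumes "\<And>b. norm (b - e * b) \<le> norm b"
  shows "norm e \<le> 2"
proof -
  have "(norm e)\<^sup>2 = norm (e * star e)" by (simp add: norm_mult_star)
  also have "\<dots> \<le> norm (star e) + norm (star e - e * star e)"
    using norm_triangle_ineq4[of "star e" "star e - e * star e"] by simp
  also have "\<dots> \<le> 2 * norm e" using assms[of "star e"] by (simp add: norm_star)
  finally show ?thesis by (cases "norm e = 0") (simp_all add: power2_eq_square)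
qed

text \<open>
  If \<open>1 - e\<close> is small from the left on \<open>F\<close> and \<open>1 - f*\<close> from the right, their product
  \<open>1 - g = (1 - f*)(1 - e)\<close> in this order is small from both sides.
\<close>

lemma finite_two_sided_unit:
  fixes F :: "'a::cstar_algebra set"
  assumes F: "finite F" and "\<epsilon> > 0"
  shows "\<exists>g. norm g \<le> 8 \<and> (\<forall>a\<in>F. norm (g * a - a) < \<epsilon> \<and> norm (a * g - a) < \<epsilon>)"
proof -
  have \<epsilon>: "\<epsilon> / 3 > 0" using assms by simp
  obtain e where e: "\<And>b. norm (b - e * b) \<le> norm b" "\<And>a. a \<in> F \<Longrightarrow> norm (a - e * a) < \<epsilon> / 3"
    using finite_left_unit[OF F \<epsilon>] by blast
  obtain f where f: "\<And>b. norm (b - f * b) \<le> norm b" "\<And>a. a \<in> star ` F \<Longrightarrow> norm (a - f * a) < \<epsilon> / 3"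
    using finite_left_unit[OF finite_imageI[OF F] \<epsilon>, of star] by blast
  have ne: "norm e \<le> 2" and nf: "norm (star f) \<le> 2"
    using norm_le_two_of_left_unit e(1) f(1) by (auto simp: norm_star)
  have f': "norm (a - a * star f) < \<epsilon> / 3" if "a \<in> F" for a
    using f(2)[of "star a"] that norm_star[of "a - a * star f"] by (simp add: star_diff star_mult star_star)
  define g where "g = star f + e - star f * e"
  have bound: "norm (c * d) \<le> 2 * norm d" "norm (d * c) \<le> 2 * norm d" if "norm c \<le> 2" for c d :: 'a
    using norm_mult_ineq[of c d] norm_mult_ineq[of d c] mult_right_mono[OF that, of "norm d"]
    by (simp_all add: mult.commute)
  have "norm g \<le> norm (star f) + norm e + norm (star f * e)"
    unfolding g_def by (rule order_trans[OF norm_triangle_ineq4]) (simp add: norm_triangle_ineq)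
  also have "\<dots> \<le> 8" using bound(1)[OF nf, of e] ne nf by simp
  finally have "norm g \<le> 8" .
  moreover have "norm (g * a - a) < \<epsilon>" "norm (a * g - a) < \<epsilon>" if a: "a \<in> F" for a
  proof -
    have "g * a - a = star f * (a - e * a) - (a - e * a)" by (simp add: g_def algebra_simps)
    then have "norm (g * a - a) \<le> norm (star f * (a - e * a)) + norm (a - e * a)"
      by (simp only: norm_triangle_ineq4)
    then show "norm (g * a - a) < \<epsilon>" using bound(1)[OF nf, of "a - e * a"] e(2)[OF a] by simp
    have "a * g - a = (a - a * star f) * e - (a - a * star f)" by (simp add: g_def algebra_simps)
    then have "norm (a * g - a) \<le> norm ((a - a * star f) * e) + norm (a - a * star f)"
      by (simp only: norm_triangle_ineq4)
    then show "norm (a * g - a) < \<epsilon>" using bound(2)[OF ne, of "a - a * star f"] f'[OF a] by simp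
  qed
  ultimately show ?thesis by blast
qed

text \<open>
  The units for finite sets and tolerances form a filter base. A filter plays the part of a net.
\<close>

lemma approximate_unit:
  obtains \<F> :: "'a::cstar_algebra filter"
  where "\<F> \<noteq> bot" "\<forall>\<^sub>F e in \<F>. norm e \<le> 8"
    "\<And>a. ((\<lambda>e. e * a) \<longlongrightarrow> a) \<F>" "\<And>a. ((\<lambda>e. a * e) \<longlongrightarrow> a) \<F>"
proof -
  define S where "S = (\<lambda>(F, \<epsilon>). {e :: 'a. norm e \<le> 8 \<and> (\<forall>a\<in>F. norm (e * a - a) < \<epsilon> \<and> norm (a * e - a) < \<epsilon>)})"
  define I where "I = {(F :: 'a set, \<epsilon> :: real). finite F \<and> \<epsilon> > 0}"
  define \<F> where "\<F> = (INF i\<in>I. principal (S i))"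
  have "\<F> \<noteq> bot"
    unfolding \<F>_def
  proof (subst INF_filter_bot_base)
    fix i j assume "i \<in> I" "j \<in> I"
    then obtain F \<epsilon> G \<delta> where ij: "i = (F, \<epsilon>)" "j = (G, \<delta>)" "finite F" "finite G" "\<epsilon> > 0" "\<delta> > 0"
      unfolding I_def by auto
    show "\<exists>k\<in>I. principal (S k) \<le> inf (principal (S i)) (principal (S j))"
      by (rule bexI[of _ "(F \<union> G, min \<epsilon> \<delta>)"]) (auto simp: ij S_def I_def)
  next
    have "S i \<noteq> {}" if iI: "i \<in> I" for i
    proof -
      obtain F \<epsilon> where i: "i = (F, \<epsilon>)" "finite F" "\<epsilon> > 0" using iI unfolding I_def by auto
      then show ?thesis using finite_two_sided_unit[of F \<epsilon>] by (auto simp: S_def)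
    qed
    then show "\<not> (\<exists>i\<in>I. principal (S i) = bot)" by (simp add: principal_eq_bot_iff)
  qed
  have ev: "\<forall>\<^sub>F e in \<F>. e \<in> S i" if "i \<in> I" for i
    unfolding \<F>_def by (rule eventually_INF1[OF that]) (simp add: eventually_principal)
  have "\<forall>\<^sub>F e in \<F>. norm e \<le> 8"
    by (rule eventually_mono[OF ev[of "({}, 1)"]]) (auto simp: S_def I_def)
  moreover have "((\<lambda>e. e * a) \<longlongrightarrow> a) \<F>" "((\<lambda>e. a * e) \<longlongrightarrow> a) \<F>" for a
  proof -
    have E: "\<forall>\<^sub>F e in \<F>. norm (e * a - a) < \<epsilon> \<and> norm (a * e - a) < \<epsilon>" if "\<epsilon> > 0" for \<epsilon>
      by (rule eventually_mono[OF ev[of "({a}, \<epsilon>)"]]) (use that in \<open>auto simp: S_def I_def\<close>)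
    show "((\<lambda>e. e * a) \<longlongrightarrow> a) \<F>"
      by (rule tendstoI, rule eventually_mono[OF E]) (auto simp: dist_norm)
    show "((\<lambda>e. a * e) \<longlongrightarrow> a) \<F>"
      by (rule tendstoI, rule eventually_mono[OF E]) (auto simp: dist_norm)
  qed
  ultimately show thesis using \<open>\<F> \<noteq> bot\<close> that by blast
qed

section \<open>Weak* cluster points\<close>

text \<open>
  Banach-Alaoglu: the evaluations \<open>\<phi> \<mapsto> \<phi>(g e)\<close> lie in a product of discs, which is compact by Tychonoff's
  theorem; along a finer filter they converge pointwise, and the limit is linear and bounded.
\<close>

lemma weak_star_cluster_point:
  fixes g :: "'e \<Rightarrow> 'x::complex_normed_vector"
  assumes "\<F> \<noteq> bot" and bound: "\<forall>\<^sub>F e in \<F>. norm (g e) \<le> C"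
  obtains \<G> and \<xi> :: "'x cdual cdual"
  where "\<G> \<noteq> bot" "\<G> \<le> \<F>" "\<And>\<phi>. ((\<lambda>e. cdual_apply \<phi> (g e)) \<longlongrightarrow> cdual_apply \<xi> \<phi>) \<G>"
proof -
  define \<Phi> where "\<Phi> e = (\<lambda>\<phi>. cdual_apply \<phi> (g e))" for e
  define K where "K = (\<Pi>\<^sub>E \<phi>\<in>(UNIV :: 'x cdual set). cball (0::complex) (norm \<phi> * C))"
  have "compactin (product_topology (\<lambda>_. euclidean) UNIV) K"
    unfolding K_def compactin_PiE by (auto simp: compactin_euclidean_iff)
  then have "compact K" by (simp add: euclidean_product_topology compactin_euclidean_iff)
  moreover have "filtermap \<Phi> \<F> \<noteq> bot" using assms(1) by (simp add: filtermap_bot_iff)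
  moreover have "\<forall>\<^sub>F f in filtermap \<Phi> \<F>. f \<in> K"
    unfolding eventually_filtermap using bound
  proof (rule eventually_mono)
    fix e assume e: "norm (g e) \<le> C"
    have "norm (cdual_apply \<phi> (g e)) \<le> norm \<phi> * C" for \<phi>
      by (rule order_trans[OF norm_cdual_apply mult_left_mono[OF e]]) simp
    then show "\<Phi> e \<in> K" unfolding K_def \<Phi>_def by (simp add: PiE_iff)
  qed
  ultimately obtain l where l: "l \<in> K" "inf (nhds l) (filtermap \<Phi> \<F>) \<noteq> bot"
    unfolding compact_filter by blast
  define \<G> where "\<G> = inf \<F> (filtercomap \<Phi> (nhds l))"
  have nb: "\<G> \<noteq> bot"
  proof
    assume "\<G> = bot"
    then have "eventually (\<lambda>_. False) \<G>" by simp
    then obtain P Q where PQ: "eventually P \<F>" "eventually Q (filtercomap \<Phi> (nhds l))" "\<And>e. \<not> (P e \<and> Q e)"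
      unfolding \<G>_def eventually_inf by auto
    then obtain R where R: "eventually R (nhds l)" "\<And>e. R (\<Phi> e) \<Longrightarrow> Q e"
      unfolding eventually_filtercomap by auto
    have "eventually (\<lambda>f. \<not> R f) (filtermap \<Phi> \<F>)"
      unfolding eventually_filtermap using PQ(1) by (rule eventually_mono) (use PQ(3) R(2) in blast)
    then have "eventually (\<lambda>_. False) (inf (nhds l) (filtermap \<Phi> \<F>))"
      unfolding eventually_inf using R(1) by blast
    then show False using l(2) by (simp add: eventually_False)
  qed
  have "filterlim \<Phi> (nhds l) \<G>"
    unfolding filterlim_iff_le_filtercomap \<G>_def by simp
  then have lim: "((\<lambda>e. cdual_apply \<phi> (g e)) \<longlongrightarrow> l \<phi>) \<G>" for \<phi>
  proof -
    have "continuous_on UNIV (\<lambda>f :: 'x cdual \<Rightarrow> complex. f \<phi>)"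
      by (rule continuous_on_product_then_coordinatewise[OF continuous_on_id])
    from continuous_on_tendsto_compose[OF this \<open>filterlim \<Phi> (nhds l) \<G>\<close>]
    show ?thesis by (simp add: \<Phi>_def)
  qed
  have eq: "l \<psi> = c" if "((\<lambda>e. cdual_apply \<psi> (g e)) \<longlongrightarrow> c) \<G>" for \<psi> c
    using tendsto_unique[OF nb lim that] .
  have "bounded_linear l"
  proof (rule bounded_linear_intro[where K = C])
    fix \<phi> \<psi> :: "'x cdual" and r :: real
    show "l (\<phi> + \<psi>) = l \<phi> + l \<psi>"
      by (rule eq) (simp add: cdual_apply_add_left tendsto_add[OF lim lim])
    show "l (r *\<^sub>R \<phi>) = r *\<^sub>R l \<phi>"
      by (rule eq) (simp only: cdual_apply_scaleR_left tendsto_scaleR[OF tendsto_const lim])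
    show "norm (l \<phi>) \<le> norm \<phi> * C" using l(1) by (auto simp: K_def PiE_iff)
  qed
  moreover have "l (c *\<^sub>C \<phi>) = c *\<^sub>C l \<phi>" for c \<phi>
    by (rule eq) (simp only: cdual_apply_scaleC_left scaleC_complex_def tendsto_mult[OF tendsto_const lim])
  ultimately have "bounded_clinear l" by (simp add: bounded_clinear_iff)
  then have "cdual_apply (cdual_of l) = l" by (rule cdual_apply_cdual_of)
  then show thesis using that[of \<G> "cdual_of l"] nb lim unfolding \<G>_def by simp
qed

section \<open>The central multiplier annihilates commutators\<close>

context banach_bimodule
begin

lemmas lact_add_left = bounded_bilinear.add_left[OF bounded_bilinear_lact]
  and lact_add_right = bounded_bilinear.add_right[OF bounded_bilinear_lact]
  and lact_diff_left = bounded_bilinear.diff_left[OF bounded_bilinear_lact]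
  and lact_diff_right = bounded_bilinear.diff_right[OF bounded_bilinear_lact]
  and lact_minus_left = bounded_bilinear.minus_left[OF bounded_bilinear_lact]
  and lact_minus_right = bounded_bilinear.minus_right[OF bounded_bilinear_lact]
  and lact_zero_left = bounded_bilinear.zero_left[OF bounded_bilinear_lact]
  and lact_zero_right = bounded_bilinear.zero_right[OF bounded_bilinear_lact]
  and ract_add_left = bounded_bilinear.add_left[OF bounded_bilinear_ract]
  and ract_add_right = bounded_bilinear.add_right[OF bounded_bilinear_ract]
  and ract_diff_left = bounded_bilinear.diff_left[OF bounded_bilinear_ract]
  and ract_diff_right = bounded_bilinear.diff_right[OF bounded_bilinear_ract]
  and ract_minus_left = bounded_bilinear.minus_left[OF bounded_bilinear_ract]
  and ract_minus_right = bounded_bilinear.minus_right[OF bounded_bilinear_ract]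
  and ract_zero_left = bounded_bilinear.zero_left[OF bounded_bilinear_ract]
  and ract_zero_right = bounded_bilinear.zero_right[OF bounded_bilinear_ract]

lemmas bimodule_additive =
  lact_add_left lact_add_right lact_diff_left lact_diff_right lact_minus_left lact_minus_right
  lact_zero_left lact_zero_right ract_add_left ract_add_right ract_diff_left ract_diff_right
  ract_minus_left ract_minus_right ract_zero_left ract_zero_right

lemmas bimodule_simps = bimodule_additive lact_mult ract_mult lact_ract

text \<open>
  Here \<open>d\<close> is an anti-derivation up to a central term. Expanding \<open>d(abc)\<close> in the two possible ways
  gives \<open>d(c)[a,b] = [b,c]d(a)\<close>, the central terms cancelling against each other.
\<close>

lemma defect_exchange:
  assumes \<xi>: "\<And>a. lact a \<xi> = ract \<xi> a"
    and add: "\<And>a b. d (a + b) = d a + d b"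
    and d: "\<And>a b. d (a * b) = ract (d b) a + lact b (d a) - 2 *\<^sub>R ract \<xi> (commutator a b)"
  shows "ract (d c) (commutator a b) = lact (commutator b c) (d a)"
proof -
  have "d ((a * b) * c) = d (a * (b * c))" by (simp add: mult.assoc)
  then show ?thesis
    unfolding d commutator_def
    by (simp add: bimodule_simps \<xi> scaleR_2 algebra_simps)
qed

text \<open>
  The choice \<open>c = b\<close> in \<open>d(c)[a,b] = [b,c]d(a)\<close> gives \<open>d(b)[a,b] = 0\<close>, hence \<open>d(b)x[y,b] = 0\<close> for all \<open>x\<close>, \<open>y\<close>.
  Applied to \<open>d(ab)\<close> and \<open>[a,ab] = az\<close>, where \<open>z = [a,b]\<close>, the terms containing \<open>d\<close> vanish again, and only
  the central term \<open>\<xi>zxaz\<close> remains.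
\<close>

lemma defect_annihilates_commutators:
  fixes \<xi> :: 'x and d :: "'a \<Rightarrow> 'x"
  assumes \<xi>: "\<And>a. lact a \<xi> = ract \<xi> a"
    and add: "\<And>a b. d (a + b) = d a + d b"
    and d: "\<And>a b. d (a * b) = ract (d b) a + lact b (d a) - 2 *\<^sub>R ract \<xi> (commutator a b)"
  shows "ract \<xi> (commutator a b * x * (a * commutator a b)) = 0"
proof -
  have sw: "ract (d c) (commutator a b) = lact (commutator b c) (d a)" for a b c
    by (rule defect_exchange[OF \<xi> add d])
  have 0: "ract (d b) (commutator a b) = 0" for a b
    using sw[of b a b] by (simp add: commutator_def bimodule_additive)
  have 1: "ract (ract (d b) x) (commutator a b) = 0" for a b x
  proof -
    have "x * commutator a b = commutator (x * a) b - commutator x b * a"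
      by (simp add: commutator_def algebra_simps)
    then have "ract (d b) (x * commutator a b) = 0"
      using 0[of b "x * a"] 0[of b x] by (simp add: ract_diff_right ract_mult lact_zero_left ract_zero_left)
    then show ?thesis by (simp only: ract_mult)
  qed
  have 2: "ract (ract (d b) x) (commutator y c) = - ract (ract (d c) x) (commutator y b)" for b c x y
  proof -
    have "commutator y (b + c) = commutator y b + commutator y c"
      by (simp add: commutator_def algebra_simps)
    then have "ract (ract (d b) x) (commutator y c) + ract (ract (d c) x) (commutator y b) = 0"
      using 1[of "b + c" x y] 1[of b x y] 1[of c x y] by (simp add: add ract_add_left ract_add_right add.commute)
    then show ?thesis by (simp only: eq_neg_iff_add_eq_0)
  qed
  define z where "z = commutator a b"
  have ca: "commutator a (a * b) = a * z" by (simp add: z_def commutator_def algebra_simps)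
  have "0 = ract (ract (d (a * b)) x) (a * z)" using 1[of "a * b" x a] by (simp only: ca)
  also have "\<dots> = ract (ract (ract (d b) a) x) (a * z) + ract (ract (lact b (d a)) x) (a * z)
      - 2 *\<^sub>R ract (ract (ract \<xi> z) x) (a * z)"
    by (simp add: d z_def ract_add_left ract_diff_left scaleR_2)
  also have "ract (ract (ract (d b) a) x) (a * z) = 0"
    using 1[of b "a * x * a" a] by (simp only: ract_mult z_def)
  also have "ract (ract (lact b (d a)) x) (a * z) = lact b (ract (ract (d a) (x * a)) z)"
    by (simp only: ract_mult lact_ract)
  also have "ract (ract (d a) (x * a)) z = 0"
    using 1[of a "x * a" b] by (simp add: z_def commutator_def ract_diff_right)
  finally have "2 *\<^sub>R ract (ract (ract \<xi> z) x) (a * z) = 0" by (simp add: lact_zero_right)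
  then show ?thesis unfolding z_def[symmetric] by (simp add: ract_mult)
qed

end

text \<open>
  In \<open>\<xi>zxaz = 0\<close> the unwanted factor \<open>a\<close> is removed by polarization: \<open>a\<close> is replaced by \<open>a \<plusminus> s\<close> and \<open>s\<close>
  runs through an approximate unit, for which \<open>[s,b]\<close> tends to zero. This leaves \<open>\<xi>zxz = 0\<close>. The annihilator of
  \<open>\<xi>\<close> then contains \<open>(zz*)\<^sup>2 = zz*zz*\<close>, hence \<open>zz*\<close>, hence \<open>z\<close>.
\<close>

lemma central_multiplier_annihilates_commutators:
  fixes lact :: "'a::cstar_algebra \<Rightarrow> 'x::complex_banach \<Rightarrow> 'x" and ract
  assumes bimodule: "banach_bimodule lact ract"
    and \<xi>: "\<And>a. lact a \<xi> = ract \<xi> a"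
    and add: "\<And>a b. d (a + b) = d a + d b"
    and d: "\<And>a b. d (a * b) = ract (d b) a + lact b (d a) - 2 *\<^sub>R ract \<xi> (commutator a b)"
  shows "ract \<xi> (commutator a b) = 0"
proof -
  interpret banach_bimodule lact ract by (rule bimodule)
  define z where "z = commutator a b"
  have lin: "ract \<xi> (commutator s b * x * (a * z) + z * x * (s * z) + z * x * (a * commutator s b)) = 0"
    for s x
  proof -
    define w where "w = commutator s b"
    have c: "commutator (a + s) b = z + w" "commutator (a - s) b = z - w"
      by (simp_all add: z_def w_def commutator_def algebra_simps)
    let ?L = "w * x * (a * z) + z * x * (s * z) + z * x * (a * w)"
    have "?L + ?L = (z + w) * x * ((a + s) * (z + w)) - (z - w) * x * ((a - s) * (z - w))
        - w * x * (s * w) - w * x * (s * w)"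
      by (simp add: algebra_simps)
    then have "ract \<xi> (?L + ?L) = 0"
      using defect_annihilates_commutators[OF \<xi> add d, of "a + s" b x]
        defect_annihilates_commutators[OF \<xi> add d, of "a - s" b x]
        defect_annihilates_commutators[OF \<xi> add d, of s b x]
      unfolding c w_def[symmetric] by (simp only: ract_diff_right) simp
    then have "2 *\<^sub>R ract \<xi> ?L = 0" by (simp only: ract_add_right scaleR_2)
    then show ?thesis by (simp add: w_def)
  qed
  have zxz: "ract \<xi> (z * x * z) = 0" for x
  proof -
    obtain \<F> :: "'a filter" where \<F>: "\<F> \<noteq> bot"
      "\<And>a. ((\<lambda>e. e * a) \<longlongrightarrow> a) \<F>" "\<And>a. ((\<lambda>e. a * e) \<longlongrightarrow> a) \<F>"
      using approximate_unit[where 'a = 'a] by metis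
    have w: "((\<lambda>e. commutator e b) \<longlongrightarrow> 0) \<F>"
      unfolding commutator_def using tendsto_diff[OF \<F>(2)[of b] \<F>(3)[of b]] by simp
    have "((\<lambda>e. commutator e b * x * (a * z) + z * x * (e * z) + z * x * (a * commutator e b))
        \<longlongrightarrow> 0 * x * (a * z) + z * x * z + z * x * (a * 0)) \<F>"
      by (intro tendsto_add tendsto_mult tendsto_const w \<F>(2))
    from bounded_linear.tendsto[OF bounded_bilinear.bounded_linear_right[OF bounded_bilinear_ract] this, of \<xi>]
    have "((\<lambda>e. 0) \<longlongrightarrow> ract \<xi> (z * x * z)) \<F>" by (simp add: lin)
    then show ?thesis using tendsto_unique[OF \<F>(1) _ tendsto_const] by metis
  qed
  define J where "J = {y. ract \<xi> y = 0}"
  have J: "right_ideal J"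
    by (simp add: right_ideal_def J_def ract_add_right ract_scaleC_right scaleC.zero_right ract_mult ract_zero_left)
  have "continuous_on UNIV (ract \<xi>)"
    using bounded_bilinear.bounded_linear_right[OF bounded_bilinear_ract]
    by (intro linear_continuous_on)
  then have closed: "closed J"
    unfolding J_def by (intro closed_Collect_eq continuous_on_const)
  have "z * star z * star (z * star z) = (z * star z * z) * star z"
    by (simp add: star_mult star_star mult.assoc)
  then have "z * star z * star (z * star z) \<in> J"
    using zxz[of "star z"] by (simp add: J_def ract_mult ract_zero_left)
  then have "z * star z \<in> J" by (rule closed_right_ideal_square_root[OF J closed])
  then have "z \<in> J" by (rule closed_right_ideal_square_root[OF J closed])
  then show ?thesis by (simp add: J_def z_def)
qed

section \<open>The central multiplier as a weak* limit\<close>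

text \<open>
  For uniformly bounded operators, pointwise convergence to the identity passes to limits of vectors.
\<close>

lemma closed_pointwise_identity_limit:
  fixes L :: "'e \<Rightarrow> 'x \<Rightarrow> 'x::real_normed_vector"
  assumes add: "\<And>e x y. L e (x - y) = L e x - L e y"
    and bound: "\<forall>\<^sub>F e in \<F>. \<forall>x. norm (L e x) \<le> C * norm x" and "C \<ge> 0"
  shows "closed {x. ((\<lambda>e. L e x) \<longlongrightarrow> x) \<F>}"
  unfolding closed_sequential_limits
proof (intro allI impI, elim conjE)
  fix u l assume u: "\<forall>n. u n \<in> {x. ((\<lambda>e. L e x) \<longlongrightarrow> x) \<F>}" and l: "u \<longlonglongrightarrow> l"
  have "((\<lambda>e. L e l) \<longlongrightarrow> l) \<F>"
  proof (rule tendstoI)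
    fix \<epsilon> :: real assume \<epsilon>: "\<epsilon> > 0"
    define \<delta> where "\<delta> = \<epsilon> / (2 * (C + 1))"
    have \<delta>: "\<delta> > 0" "(C + 1) * \<delta> = \<epsilon> / 2" using \<epsilon> \<open>C \<ge> 0\<close> by (simp_all add: \<delta>_def field_simps)
    obtain n where n: "dist (u n) l < \<delta>" using LIMSEQ_D[OF l \<delta>(1)] by (auto simp: dist_norm)
    have "\<forall>\<^sub>F e in \<F>. dist (L e (u n)) (u n) < \<epsilon> / 2"
      using u \<epsilon> by (intro tendstoD) auto
    with bound show "\<forall>\<^sub>F e in \<F>. dist (L e l) l < \<epsilon>"
    proof eventually_elim
      case (elim e)
      have "L e l - l = L e (l - u n) + (L e (u n) - u n) + (u n - l)" by (simp add: add)
      then have "norm (L e l - l) \<le> norm (L e (l - u n)) + norm (L e (u n) - u n) + norm (u n - l)"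
        by (metis norm_triangle_le norm_triangle_ineq add_mono order_refl)
      also have "norm (L e (l - u n)) \<le> C * norm (u n - l)"
        using elim(1) by (metis norm_minus_commute)
      finally have "norm (L e l - l) \<le> (C + 1) * norm (u n - l) + norm (L e (u n) - u n)"
        by (simp add: algebra_simps)
      also have "(C + 1) * norm (u n - l) \<le> (C + 1) * \<delta>"
        using n \<open>C \<ge> 0\<close> by (intro mult_left_mono) (auto simp: dist_norm)
      finally show ?case using elim(2) \<delta>(2) by (simp add: dist_norm)
    qed
  qed
  then show "l \<in> {x. ((\<lambda>e. L e x) \<longlongrightarrow> x) \<F>}" by simp
qed

lemma essential_bimodule_induct:
  assumes "essential_bimodule lact ract"
    and closed: "closed S" and gen: "\<And>a x b. ract (lact a x) b \<in> S"
    and add: "\<And>x y. x \<in> S \<Longrightarrow> y \<in> S \<Longrightarrow> x + y \<in> S" and scale: "\<And>c x. x \<in> S \<Longrightarrow> c *\<^sub>C x \<in> S"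
  shows "(x :: 'x::complex_banach) \<in> S"
proof -
  interpret C: vector_space "scaleC :: complex \<Rightarrow> 'x \<Rightarrow> 'x" by (rule vector_space_scaleC)
  have "0 \<in> S" using scale[OF gen, of 0] by (simp add: scaleC.zero_left)
  then have "C.subspace S" using add scale by (intro C.subspaceI) auto
  then have "C.span {ract (lact a x) b | a x b. True} \<subseteq> S"
    by (intro C.span_minimal) (use gen in auto)
  then have "closure (C.span {ract (lact a x) b | a x b. True}) \<subseteq> S"
    using closed by (rule closure_minimal)
  then show ?thesis using assms(1) unfolding essential_bimodule_def by auto
qed

lemma essential_bimodule_unit_limit:
  fixes lact :: "'a::complex_normed_algebra \<Rightarrow> 'x::complex_banach \<Rightarrow> 'x" and ract
  assumes bimodule: "banach_bimodule lact ract" and essential: "essential_bimodule lact ract"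
    and bound: "\<forall>\<^sub>F e in \<F>. norm e \<le> B" "B \<ge> 0"
    and left: "\<And>a. ((\<lambda>e. e * a) \<longlongrightarrow> a) \<F>" and right: "\<And>a. ((\<lambda>e. a * e) \<longlongrightarrow> a) \<F>"
  shows "((\<lambda>e. lact e x) \<longlongrightarrow> x) \<F>" and "((\<lambda>e. ract x e) \<longlongrightarrow> x) \<F>"
proof -
  interpret banach_bimodule lact ract by (rule bimodule)
  obtain K where K: "K \<ge> 0" "\<And>a x. norm (lact a x) \<le> norm a * norm x * K"
    using bounded_bilinear.nonneg_bounded[OF bounded_bilinear_lact] by blast
  obtain M where M: "M \<ge> 0" "\<And>x a. norm (ract x a) \<le> norm x * norm a * M"
    using bounded_bilinear.nonneg_bounded[OF bounded_bilinear_ract] by blast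
  note tl = bounded_bilinear.tendsto[OF bounded_bilinear_lact]
    and tr = bounded_bilinear.tendsto[OF bounded_bilinear_ract]
  have ts: "((\<lambda>e. c *\<^sub>C f e) \<longlongrightarrow> c *\<^sub>C y) \<F>" if "(f \<longlongrightarrow> y) \<F>" for c and f :: "'a \<Rightarrow> 'x" and y
    by (rule bounded_linear.tendsto[OF scaleC.bounded_linear_right that])
  have "x \<in> {x. ((\<lambda>e. lact e x) \<longlongrightarrow> x) \<F>}"
  proof (rule essential_bimodule_induct[OF essential])
    show "closed {x. ((\<lambda>e. lact e x) \<longlongrightarrow> x) \<F>}"
    proof (rule closed_pointwise_identity_limit)
      show "\<forall>\<^sub>F e in \<F>. \<forall>x. norm (lact e x) \<le> (B * K) * norm x"
        using bound(1)
      proof (rule eventually_mono, intro allI)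
        fix e :: 'a and x assume e: "norm e \<le> B"
        have "norm (lact e x) \<le> norm e * (norm x * K)" using K(2) by (simp add: mult.assoc)
        also have "\<dots> \<le> B * (norm x * K)" using e K(1) by (intro mult_right_mono) auto
        finally show "norm (lact e x) \<le> (B * K) * norm x" by (simp add: mult_ac)
      qed
    qed (use K bound(2) in \<open>simp_all add: lact_diff_right\<close>)
    fix a y b
    have "((\<lambda>e. ract (lact (e * a) y) b) \<longlongrightarrow> ract (lact a y) b) \<F>"
      by (intro tr tl left tendsto_const)
    then show "ract (lact a y) b \<in> {x. ((\<lambda>e. lact e x) \<longlongrightarrow> x) \<F>}" by (simp add: lact_ract lact_mult)
  qed (use tendsto_add ts in \<open>auto simp: lact_add_right lact_scaleC_right\<close>)
  then show "((\<lambda>e. lact e x) \<longlongrightarrow> x) \<F>" by simp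
  have "x \<in> {x. ((\<lambda>e. ract x e) \<longlongrightarrow> x) \<F>}"
  proof (rule essential_bimodule_induct[OF essential])
    show "closed {x. ((\<lambda>e. ract x e) \<longlongrightarrow> x) \<F>}"
    proof (rule closed_pointwise_identity_limit)
      show "\<forall>\<^sub>F e in \<F>. \<forall>x. norm (ract x e) \<le> (B * M) * norm x"
        using bound(1)
      proof (rule eventually_mono, intro allI)
        fix e :: 'a and x assume e: "norm e \<le> B"
        have "norm (ract x e) \<le> norm e * (norm x * M)" using M(2) by (simp add: mult_ac)
        also have "\<dots> \<le> B * (norm x * M)" using e M(1) by (intro mult_right_mono) auto
        finally show "norm (ract x e) \<le> (B * M) * norm x" by (simp add: mult_ac)
      qed
    qed (use M bound(2) in \<open>simp_all add: ract_diff_left\<close>)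
    fix a y b
    have "((\<lambda>e. ract (lact a y) (b * e)) \<longlongrightarrow> ract (lact a y) b) \<F>"
      by (intro tr right tendsto_const)
    then show "ract (lact a y) b \<in> {x. ((\<lambda>e. ract x e) \<longlongrightarrow> x) \<F>}" by (simp add: ract_mult)
  next
    have pointwise: "ract (x + y) = (\<lambda>e. ract x e + ract y e)" "ract (c *\<^sub>C x) = (\<lambda>e. c *\<^sub>C ract x e)" for x y c
      by (simp_all add: fun_eq_iff ract_add_left ract_scaleC_left)
    fix y z and c
    assume "y \<in> {x. ((\<lambda>e. ract x e) \<longlongrightarrow> x) \<F>}"
    then have y: "((\<lambda>e. ract y e) \<longlongrightarrow> y) \<F>" by simp
    then show "c *\<^sub>C y \<in> {x. ((\<lambda>e. ract x e) \<longlongrightarrow> x) \<F>}" using ts[OF y] by (simp add: pointwise)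
    assume "z \<in> {x. ((\<lambda>e. ract x e) \<longlongrightarrow> x) \<F>}"
    then show "y + z \<in> {x. ((\<lambda>e. ract x e) \<longlongrightarrow> x) \<F>}"
      using tendsto_add[OF y] by (simp add: pointwise)
  qed
  then show "((\<lambda>e. ract x e) \<longlongrightarrow> x) \<F>" by simp
qed

lemma bounded_bilinear_plus:
  assumes "bounded_bilinear f" "bounded_bilinear g"
  shows "bounded_bilinear (\<lambda>a b. f a b + g a b)"
proof -
  interpret f: bounded_bilinear f by fact
  interpret g: bounded_bilinear g by fact
  obtain K L where "\<And>a b. norm (f a b) \<le> norm a * norm b * K" "\<And>a b. norm (g a b) \<le> norm a * norm b * L"
    using f.bounded g.bounded by blast
  then have "norm (f a b + g a b) \<le> norm a * norm b * (K + L)" for a b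
    by (metis add_mono distrib_left norm_triangle_le)
  then show ?thesis
    by unfold_locales (auto simp: f.add_left f.add_right g.add_left g.add_right
        f.scaleR_left f.scaleR_right g.scaleR_left g.scaleR_right scaleR_add_right)
qed

text \<open>
  The balance property of the bilinear map \<open>(a, b) \<mapsto> T(b)a + bT(a)\<close>, which vanishes on zero products by
  hypothesis.
\<close>

lemma anti_derivable_at_zero_balanced:
  fixes lact :: "'a::cstar_algebra \<Rightarrow> 'x::complex_banach \<Rightarrow> 'x" and ract
  assumes bimodule: "banach_bimodule lact ract" and T: "bounded_clinear T"
    and zero: "anti_derivable_at_zero lact ract T"
  shows "ract (T c) (a * b) + lact c (T (a * b)) = ract (T (b * c)) a + lact (b * c) (T a)"
proof -
  interpret banach_bimodule lact ract by (rule bimodule)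
  have bT: "bounded_linear T" and sT: "T (s *\<^sub>C a) = s *\<^sub>C T a" for s a
    using T by (simp_all add: bounded_clinear_iff)
  have r: "bounded_bilinear (\<lambda>a b. ract (T b) a)"
    by (rule bounded_bilinear.flip[OF bounded_bilinear.comp[OF bounded_bilinear_ract bT bounded_linear_ident]])
  have l: "bounded_bilinear (\<lambda>a b. lact b (T a))"
    by (rule bounded_bilinear.flip[OF bounded_bilinear.comp[OF bounded_bilinear_lact bounded_linear_ident bT]])
  show ?thesis
    by (rule zero_product_balanced[OF bounded_bilinear_plus[OF r l]])
      (use zero in \<open>simp_all add: anti_derivable_at_zero_def sT lact_scaleC_left lact_scaleC_right
        ract_scaleC_left ract_scaleC_right scaleC_add_right\<close>)
qed

lemma bidual_embed_add: "bidual_embed (x + y) = bidual_embed x + bidual_embed y"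
  by (rule cdual_eqI) (simp add: cdual_apply_bidual_embed cdual_apply_add cdual_apply_add_left)

lemma bidual_embed_scaleC: "bidual_embed (c *\<^sub>C x) = c *\<^sub>C bidual_embed x"
  by (rule cdual_eqI) (simp add: cdual_apply_bidual_embed cdual_apply_scaleC cdual_apply_scaleC_left)

text \<open>
  The functional \<open>\<xi>\<close> is a weak* cluster point of \<open>T(e)\<close> along an approximate unit. The two product
  formulas (\<open>c = e\<close> and \<open>a = e\<close> in the balance identity) show that \<open>\<xi>\<close> commutes with products, and every
  element is a limit of products.
\<close>

lemma anti_derivable_at_zero_multiplier:
  fixes lact :: "'a::cstar_algebra \<Rightarrow> 'x::complex_banach \<Rightarrow> 'x" and ract
  assumes bimodule: "banach_bimodule lact ract" and essential: "essential_bimodule lact ract"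
    and T: "bounded_clinear T" and zero: "anti_derivable_at_zero lact ract T"
  obtains \<xi> where "\<And>a. bidual_lact lact a \<xi> = bidual_ract ract \<xi> a"
    "\<And>a b. bidual_embed (T (a * b)) =
      bidual_embed (ract (T b) a) + bidual_embed (lact b (T a)) - bidual_ract ract \<xi> (a * b)"
proof -
  interpret banach_bimodule lact ract by (rule bimodule)
  interpret bidual: banach_bimodule "bidual_lact lact" "bidual_ract ract"
    by (rule banach_bimodule_bidual[OF bimodule])
  obtain \<F> :: "'a filter" where \<F>: "\<F> \<noteq> bot" "\<forall>\<^sub>F e in \<F>. norm e \<le> 8"
    "\<And>a. ((\<lambda>e. e * a) \<longlongrightarrow> a) \<F>" "\<And>a. ((\<lambda>e. a * e) \<longlongrightarrow> a) \<F>"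
    using approximate_unit[where 'a = 'a] by metis
  have bT: "bounded_linear T" using T by (simp add: bounded_clinear_def)
  obtain K where K: "K \<ge> 0" "\<And>a. norm (T a) \<le> norm a * K"
    using bounded_linear.nonneg_bounded[OF bT] by blast
  have "\<forall>\<^sub>F e in \<F>. norm (T e) \<le> 8 * K"
    using \<F>(2) by (rule eventually_mono) (meson K mult_right_mono order_trans)
  then obtain \<G> and \<xi> :: "'x cdual cdual" where \<G>: "\<G> \<noteq> bot" "\<G> \<le> \<F>"
    and \<xi>: "\<And>\<phi>. ((\<lambda>e. cdual_apply \<phi> (T e)) \<longlongrightarrow> cdual_apply \<xi> \<phi>) \<G>"
    by (rule weak_star_cluster_point[OF \<F>(1)]) blast
  have left: "((\<lambda>e. e * a) \<longlongrightarrow> a) \<G>" and right: "((\<lambda>e. a * e) \<longlongrightarrow> a) \<G>" for a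
    using \<F>(3,4) \<G>(2) by (auto intro: tendsto_mono)
  have "\<forall>\<^sub>F e in \<G>. norm e \<le> 8" using \<F>(2) \<G>(2) by (rule filter_leD[rotated])
  note unit = essential_bimodule_unit_limit[OF bimodule essential this _ left right, simplified]
  have \<phi>: "((\<lambda>e. cdual_apply \<phi> (f e)) \<longlongrightarrow> cdual_apply \<phi> y) \<G>" if "(f \<longlongrightarrow> y) \<G>" for f y and \<phi> :: "'x cdual"
    using bounded_clinear_cdual_apply[of \<phi>] bounded_linear.tendsto[OF _ that]
    unfolding bounded_clinear_def by blast
  have \<xi>r: "((\<lambda>e. cdual_apply \<phi> (ract (T e) a)) \<longlongrightarrow> cdual_apply (bidual_ract ract \<xi> a) \<phi>) \<G>" for \<phi> a
    using \<xi>[of "cadjoint (\<lambda>x. ract x a) \<phi>"]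
    by (simp add: cdual_apply_bidual_ract cdual_apply_cadjoint_ract)
  have \<xi>l: "((\<lambda>e. cdual_apply \<phi> (lact a (T e))) \<longlongrightarrow> cdual_apply (bidual_lact lact a \<xi>) \<phi>) \<G>" for \<phi> a
    using \<xi>[of "cadjoint (lact a) \<phi>"]
    by (simp add: cdual_apply_bidual_lact cdual_apply_cadjoint_lact)
  note tl = bounded_bilinear.tendsto[OF bounded_bilinear_lact]
    and tr = bounded_bilinear.tendsto[OF bounded_bilinear_ract]
    and tT = bounded_linear.tendsto[OF bT]
  note balanced = anti_derivable_at_zero_balanced[OF bimodule T zero]
  \<comment> \<open>The limit of the balance identity with its third variable running through the approximate unit.\<close>
  have right_limit: "bidual_ract ract \<xi> (a * b) + bidual_embed (T (a * b)) =
      bidual_embed (ract (T b) a) + bidual_embed (lact b (T a))" for a b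
  proof (rule cdual_eqI)
    fix \<phi>
    have "((\<lambda>e. cdual_apply \<phi> (ract (T e) (a * b)) + cdual_apply \<phi> (lact e (T (a * b)))) \<longlongrightarrow>
        cdual_apply (bidual_ract ract \<xi> (a * b)) \<phi> + cdual_apply \<phi> (T (a * b))) \<G>"
      by (intro tendsto_add \<xi>r \<phi> unit(1))
    moreover have "((\<lambda>e. cdual_apply \<phi> (ract (T (b * e)) a) + cdual_apply \<phi> (lact (b * e) (T a))) \<longlongrightarrow>
        cdual_apply \<phi> (ract (T b) a) + cdual_apply \<phi> (lact b (T a))) \<G>"
      by (intro tendsto_add \<phi> tr tl tT right tendsto_const)
    moreover have "cdual_apply \<phi> (ract (T e) (a * b)) + cdual_apply \<phi> (lact e (T (a * b))) =
        cdual_apply \<phi> (ract (T (b * e)) a) + cdual_apply \<phi> (lact (b * e) (T a))" for e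
      using balanced[of e a b] by (simp flip: cdual_apply_add)
    ultimately show "cdual_apply (bidual_ract ract \<xi> (a * b) + bidual_embed (T (a * b))) \<phi> =
        cdual_apply (bidual_embed (ract (T b) a) + bidual_embed (lact b (T a))) \<phi>"
      using tendsto_unique[OF \<G>(1)] by (simp add: cdual_apply_add_left cdual_apply_bidual_embed)
  qed
  \<comment> \<open>The limit with the first variable running through the approximate unit.\<close>
  have left_limit: "bidual_embed (ract (T c) b) + bidual_embed (lact c (T b)) =
      bidual_embed (T (b * c)) + bidual_lact lact (b * c) \<xi>" for b c
  proof (rule cdual_eqI)
    fix \<phi>
    have "((\<lambda>e. cdual_apply \<phi> (ract (T c) (e * b)) + cdual_apply \<phi> (lact c (T (e * b)))) \<longlongrightarrow>
        cdual_apply \<phi> (ract (T c) b) + cdual_apply \<phi> (lact c (T b))) \<G>"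
      by (intro tendsto_add \<phi> tr tl tT left tendsto_const)
    moreover have "((\<lambda>e. cdual_apply \<phi> (ract (T (b * c)) e) + cdual_apply \<phi> (lact (b * c) (T e))) \<longlongrightarrow>
        cdual_apply \<phi> (T (b * c)) + cdual_apply (bidual_lact lact (b * c) \<xi>) \<phi>) \<G>"
      by (intro tendsto_add \<xi>l \<phi> unit(2))
    moreover have "cdual_apply \<phi> (ract (T c) (e * b)) + cdual_apply \<phi> (lact c (T (e * b))) =
        cdual_apply \<phi> (ract (T (b * c)) e) + cdual_apply \<phi> (lact (b * c) (T e))" for e
      using balanced[of c e b] by (simp flip: cdual_apply_add)
    ultimately show "cdual_apply (bidual_embed (ract (T c) b) + bidual_embed (lact c (T b))) \<phi> =
        cdual_apply (bidual_embed (T (b * c)) + bidual_lact lact (b * c) \<xi>) \<phi>"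
      using tendsto_unique[OF \<G>(1)] by (simp add: cdual_apply_add_left cdual_apply_bidual_embed)
  qed
  have products: "bidual_lact lact (a * b) \<xi> = bidual_ract ract \<xi> (a * b)" for a b
    using left_limit[of b a] right_limit[of a b] by (simp add: add.commute)
  have "bidual_lact lact a \<xi> = bidual_ract ract \<xi> a" for a
  proof -
    have "((\<lambda>e. bidual_lact lact (a * e) \<xi>) \<longlongrightarrow> bidual_lact lact a \<xi>) \<G>"
      by (intro bounded_bilinear.tendsto[OF bidual.bounded_bilinear_lact] right tendsto_const)
    moreover have "((\<lambda>e. bidual_ract ract \<xi> (a * e)) \<longlongrightarrow> bidual_ract ract \<xi> a) \<G>"
      by (intro bounded_bilinear.tendsto[OF bidual.bounded_bilinear_ract] right tendsto_const)
    ultimately show ?thesis using tendsto_unique[OF \<G>(1)] by (simp add: products)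
  qed
  moreover have "bidual_embed (T (a * b)) =
      bidual_embed (ract (T b) a) + bidual_embed (lact b (T a)) - bidual_ract ract \<xi> (a * b)" for a b
    using right_limit[of a b] by (simp add: eq_diff_eq add.commute)
  ultimately show thesis by (rule that)
qed

theorem theorem6:
  fixes lact :: "'a::cstar_algebra \<Rightarrow> 'x::complex_banach \<Rightarrow> 'x"
    and ract :: "'x \<Rightarrow> 'a \<Rightarrow> 'x"
    and T :: "'a \<Rightarrow> 'x"
  assumes "banach_bimodule lact ract"
    and "essential_bimodule lact ract"
    and "bounded_clinear T"
  shows "anti_derivable_at_zero lact ract T \<longleftrightarrow>
    (\<exists>(d :: 'a \<Rightarrow> 'x cdual cdual) (\<xi> :: 'x cdual cdual).
      anti_derivation (bidual_lact lact) (bidual_ract ract) d \<and>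
      (\<forall>a b.
        bidual_ract ract \<xi> a = bidual_lact lact a \<xi> \<and>
        bidual_ract ract \<xi> (commutator a b) = 0 \<and>
        bidual_embed (T (a * b)) =
          bidual_embed (lact b (T a)) + bidual_embed (ract (T b) a)
            - bidual_ract ract (bidual_lact lact b \<xi>) a \<and>
        bidual_embed (T a) = d a + bidual_ract ract \<xi> a))"
    (is "?zero \<longleftrightarrow> (\<exists>d \<xi>. ?rep d \<xi>)")
proof
  interpret banach_bimodule lact ract by (rule assms(1))
  interpret bidual: banach_bimodule "bidual_lact lact" "bidual_ract ract"
    by (rule banach_bimodule_bidual[OF assms(1)])
  have T_add: "T (a + b) = T a + T b" and T_scale: "T (s *\<^sub>C a) = s *\<^sub>C T a" for a b s
    using assms(3) by (auto simp: bounded_clinear_iff linear_add bounded_linear.linear)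
  {
    assume ?zero
    then obtain \<xi> where central: "\<And>a. bidual_lact lact a \<xi> = bidual_ract ract \<xi> a"
      and T_mult: "\<And>a b. bidual_embed (T (a * b)) =
        bidual_embed (ract (T b) a) + bidual_embed (lact b (T a)) - bidual_ract ract \<xi> (a * b)"
      by (rule anti_derivable_at_zero_multiplier[OF assms]) blast
    define d where "d a = bidual_embed (T a) - bidual_ract ract \<xi> a" for a
    have d_add: "d (a + b) = d a + d b" for a b
      by (simp add: d_def T_add bidual_embed_add bidual.ract_add_right)
    have d_mult: "d (a * b) = bidual_ract ract (d b) a + bidual_lact lact b (d a)
        - 2 *\<^sub>R bidual_ract ract \<xi> (commutator a b)" for a b
      unfolding d_def T_mult commutator_def
      by (simp add: bidual.bimodule_simps bidual_lact_embed bidual_ract_embed central scaleR_2)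
    have kills: "bidual_ract ract \<xi> (commutator a b) = 0" for a b
      by (rule central_multiplier_annihilates_commutators[OF bidual.banach_bimodule_axioms central d_add d_mult])
    have "d (s *\<^sub>C a) = s *\<^sub>C d a" for s a
      by (simp add: d_def T_scale bidual_embed_scaleC bidual.ract_scaleC_right scaleC.diff_right)
    then have "clinear d" by (intro clinearI d_add)
    then have "anti_derivation (bidual_lact lact) (bidual_ract ract) d"
      by (simp add: anti_derivation_def d_mult kills)
    moreover have "bidual_ract ract (bidual_lact lact b \<xi>) a = bidual_ract ract \<xi> (a * b)" for a b
      using kills[of a b] by (simp add: central commutator_def bidual.ract_diff_right bidual.ract_mult)
    ultimately have "?rep d \<xi>"
      by (simp add: central kills T_mult d_def add.commute)
    then show "\<exists>d \<xi>. ?rep d \<xi>" by blast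
  }
  assume "\<exists>d \<xi>. ?rep d \<xi>"
  then obtain \<xi> where central: "\<And>a. bidual_ract ract \<xi> a = bidual_lact lact a \<xi>"
    and kills: "\<And>a b. bidual_ract ract \<xi> (commutator a b) = 0"
    and T_mult: "\<And>a b. bidual_embed (T (a * b)) = bidual_embed (lact b (T a)) + bidual_embed (ract (T b) a)
      - bidual_ract ract (bidual_lact lact b \<xi>) a"
    by blast
  show ?zero
    unfolding anti_derivable_at_zero_def
  proof (intro allI impI)
    fix a b :: 'a assume ab: "a * b = 0"
    have zero: "bidual_embed (T 0) = 0"
      using T_scale[of 0 0] bidual_embed_scaleC[of 0 "T 0"] by (simp add: scaleC.zero_left)
    have "bidual_ract ract (bidual_lact lact b \<xi>) a = bidual_ract ract \<xi> (b * a)"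
      by (simp add: central[symmetric] bidual.ract_mult)
    also have "\<dots> = bidual_ract ract \<xi> (a * b)"
      using kills[of a b] by (simp add: commutator_def bidual.ract_diff_right)
    also have "\<dots> = 0" by (simp add: ab bidual.ract_zero_right)
    finally have "bidual_embed (ract (T b) a + lact b (T a)) = 0"
      using T_mult[of a b] by (simp add: ab zero bidual_embed_add add.commute)
    then show "ract (T b) a + lact b (T a) = 0" by (rule bidual_embed_eq_zero)
  qed
qed

end
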